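(* Let $F$ be a Finsler metric on an $n$-dimensional manifold $M$ ($n\geq3$) of scalar flag curvature $\mathbf K=\mathbf K(x,y)$. Then for every index $k$, $$F\,\mathbf K_{|k}-F_{\cdot k}\,\mathbf K_{|m}y^m-\frac13F\,\mathbf K_{\cdot k|m}y^m=0,$$ or, equivalently, $$\Big[\frac{\mathbf K_{|m}y^m}{F}\Big]_{\cdot k}=\frac43\,\frac{\mathbf K_{\cdot k|m}y^m}{F}.$$
   Context: A Finsler metric on a manifold $M$ is a function $F=F(x,y)$ on $TM$, $C^\infty$ on $TM\setminus\{0\}$, with $F\ge 0$ and $F(x,y)=0$ iff $y=0$, $F(x,\lambda y)=\lambda F(x,y)$ for $\lambda\ge 0$, and with $g_{ij}=\frac12 [F^2]_{y^iy^j}$ positive definite for $y\ne0$. Geodesic coefficients: $G^i=\frac14 g^{il}\{[F^2]_{x^my^l}y^m-[F^2]_{x^l}\}$. Riemann curvature: $R^i_{\ k}=2\frac{\partial G^i}{\partial x^k}-\frac{\partial^2G^i}{\partial x^l\partial y^k}y^l+2G^l\frac{\partial^2G^i}{\partial y^l\partial y^k}-\frac{\partial G^i}{\partial y^l}\frac{\partial G^l}{\partial y^k}$. $F$ is of scalar flag curvature $\mathbf K=\mathbf K(x,y)$ if $R^i_{\ k}=\mathbf K\{F^2\delta^i_k-FF_{y^k}y^i\}$. Notation: $T_{\cdot k}=\partial T/\partial y^k$. The symbol "$|$" denotes the horizontal covariant derivative of the Berwald connection: for a function $T(x,y)$, $T_{|j}=\frac{\partial T}{\partial x^j}-\frac{\partial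 G^m}{\partial y^j}\frac{\partial T}{\partial y^m}$; for a covector $T_i(x,y)$, $T_{i|j}=\frac{\partial T_i}{\partial x^j}-\frac{\partial G^m}{\partial y^j}\frac{\partial T_i}{\partial y^m}-\frac{\partial^2G^m}{\partial y^i\partial y^j}T_m$. $\mathbf K_{\cdot k|m}$ is the covariant derivative of the covector $\mathbf K_{\cdot k}$. *)

theory Defs
  imports "HOL-Analysis.Analysis"
begin

text \<open>On an open set of a finite-dimensional space, \<open>Ck_on k f S\<close> says that all iterated
  directional derivatives of \<open>f\<close> up to order \<open>k\<close> exist and are continuous on \<open>S\<close>.\<close>

primrec Ck_on :: "nat \<Rightarrow> ('a::real_normed_vector \<Rightarrow> 'b::real_normed_vector) \<Rightarrow> 'a set \<Rightarrow> bool" where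
  "Ck_on 0 f S \<longleftrightarrow> continuous_on S f"
| "Ck_on (Suc k) f S \<longleftrightarrow>
     (\<forall>x\<in>S. f differentiable (at x)) \<and> (\<forall>v. Ck_on k (\<lambda>x. frechet_derivative f (at x) v) S)"

definition smooth_on :: "('a::real_normed_vector \<Rightarrow> 'b::real_normed_vector) \<Rightarrow> 'a set \<Rightarrow> bool" where
  "smooth_on f S \<longleftrightarrow> (\<forall>k. Ck_on k f S)"


section \<open>Smooth manifolds and their tangent bundle\<close>

text \<open>A chart is a pair of its domain and its coordinate map; the values of the coordinate map
  outside the domain are irrelevant.\<close>

type_synonym ('a, 'n) chart = "'a set \<times> ('a \<Rightarrow> real^'n)"

abbreviation chart_image :: "('a, 'n::finite) chart \<Rightarrow> (real^'n) set" where
  "chart_image c \<equiv> snd c ` fst c"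

abbreviation chart_inv :: "('a, 'n::finite) chart \<Rightarrow> real^'n \<Rightarrow> 'a" where
  "chart_inv c \<equiv> inv_into (fst c) (snd c)"

definition transition :: "('a, 'n::finite) chart \<Rightarrow> ('a, 'n) chart \<Rightarrow> real^'n \<Rightarrow> real^'n" where
  "transition c d = snd d \<circ> chart_inv c"

definition is_chart :: "'a topology \<Rightarrow> ('a, 'n::finite) chart \<Rightarrow> bool" where
  "is_chart M c \<longleftrightarrow> openin M (fst c) \<and> open (chart_image c) \<and>
     homeomorphic_map (subtopology M (fst c)) (top_of_set (chart_image c)) (snd c)"

text \<open>The atlas \<open>A\<close> need not be maximal.\<close>

definition smooth_manifold :: "'a topology \<Rightarrow> ('a, 'n::finite) chart set \<Rightarrow> bool" where
  "smooth_manifold M A \<longleftrightarrow>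
     Hausdorff_space M \<and> second_countable M \<and>
     (\<forall>c\<in>A. is_chart M c) \<and> (\<Union>c\<in>A. fst c) = topspace M \<and>
     (\<forall>c\<in>A. \<forall>d\<in>A. smooth_on (transition c d) (snd c ` (fst c \<inter> fst d)))"

text \<open>A tangent vector at \<open>p\<close> is the family of its components in all charts around \<open>p\<close>, which are
  related by the Jacobians of the coordinate changes.  The entries at all other charts are set to
  \<open>0\<close>, so that equality of tangent vectors is equality of functions.\<close>

type_synonym ('a, 'n) tvector = "('a, 'n) chart \<Rightarrow> real^'n"

definition tangent_space :: "('a, 'n::finite) chart set \<Rightarrow> 'a \<Rightarrow> ('a, 'n) tvector set" where
  "tangent_space A p = {v.
     (\<forall>c. c \<notin> A \<or> p \<notin> fst c \<longrightarrow> v c = 0) \<and>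
     (\<forall>c\<in>A. \<forall>d\<in>A. p \<in> fst c \<longrightarrow> p \<in> fst d \<longrightarrow>
        v d = frechet_derivative (transition c d) (at (snd c p)) (v c))}"

definition tangent_bundle ::
    "'a topology \<Rightarrow> ('a, 'n::finite) chart set \<Rightarrow> ('a \<times> ('a, 'n) tvector) set" where
  "tangent_bundle M A = (SIGMA p : topspace M. tangent_space A p)"

text \<open>The tangent vector at \<open>p\<close> with components \<open>y\<close> in the chart \<open>c\<close>.\<close>

definition tangent_of ::
    "('a, 'n::finite) chart set \<Rightarrow> ('a, 'n) chart \<Rightarrow> 'a \<Rightarrow> real^'n \<Rightarrow> ('a, 'n) tvector" where
  "tangent_of A c p y = (\<lambda>d. if d \<in> A \<and> p \<in> fst d
     then frechet_derivative (transition c d) (at (snd c p)) y else 0)"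

text \<open>The following facts show that \<open>tangent_of A c p\<close> is a bijection from \<open>real^'n\<close> onto the
  tangent space at \<open>p\<close>, inverse to taking components in \<open>c\<close>.\<close>

lemma transition_domain_open:
  assumes "is_chart M c" and "is_chart M d"
  shows "open (snd c ` (fst c \<inter> fst d))"
proof -
  have sub: "fst c \<subseteq> topspace M"
    using assms(1) by (auto simp: is_chart_def dest: openin_subset)
  have "open_map (subtopology M (fst c)) (top_of_set (chart_image c)) (snd c)"
    using assms(1) homeomorphic_imp_open_map by (auto simp: is_chart_def)
  moreover have "openin (subtopology M (fst c)) (fst c \<inter> fst d)"
    using assms(2) by (metis Int_commute is_chart_def openin_subtopology_Int)
  ultimately have "openin (top_of_set (chart_image c)) (snd c ` (fst c \<inter> fst d))"
    by (simp add: open_map_def)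
  then show ?thesis
    using assms(1) openin_open_trans by (auto simp: is_chart_def)
qed

lemma chart_inj: "is_chart M c \<Longrightarrow> inj_on (snd c) (fst c)"
  by (metis homeomorphic_imp_injective_map inf.absorb_iff2 is_chart_def openin_subset
      topspace_subtopology)

lemma transition_differentiable:
  assumes "smooth_manifold M A" "c \<in> A" "d \<in> A" "p \<in> fst c" "p \<in> fst d"
  shows "transition c d differentiable (at (snd c p))"
proof -
  have "Ck_on (Suc 0) (transition c d) (snd c ` (fst c \<inter> fst d))"
    using assms unfolding smooth_manifold_def smooth_on_def by blast
  then show ?thesis using assms by auto
qed

lemma transition_cocycle:
  assumes "smooth_manifold M A" "c \<in> A" "d \<in> A" "e \<in> A" "p \<in> fst c" "p \<in> fst d" "p \<in> fst e"
  shows "frechet_derivative (transition c e) (at (snd c p)) y =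
    frechet_derivative (transition d e) (at (snd d p))
      (frechet_derivative (transition c d) (at (snd c p)) y)"
proof -
  have ch: "is_chart M c" "is_chart M d" "is_chart M e"
    using assms by (auto simp: smooth_manifold_def)
  note inj = chart_inj[OF ch(1)] chart_inj[OF ch(2)]
  have cd: "transition c d (snd c p) = snd d p"
    using inj assms by (simp add: transition_def)
  have "(transition d e has_derivative frechet_derivative (transition d e) (at (snd d p)))
      (at (transition c d (snd c p)))"
    unfolding cd using transition_differentiable[OF assms(1,3,4,6,7)] frechet_derivative_works by blast
  moreover have "(transition c d has_derivative frechet_derivative (transition c d) (at (snd c p)))
      (at (snd c p))"
    using transition_differentiable[OF assms(1,2,3,5,6)] frechet_derivative_works by blast
  ultimately have "(transition d e \<circ> transition c d has_derivative
      frechet_derivative (transition d e) (at (snd d p)) \<circ>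
      frechet_derivative (transition c d) (at (snd c p))) (at (snd c p))"
    by (intro diff_chain_at) (auto simp: cd)
  then have "(transition c e has_derivative
      frechet_derivative (transition d e) (at (snd d p)) \<circ>
      frechet_derivative (transition c d) (at (snd c p))) (at (snd c p))"
  proof (rule has_derivative_transform_within_open)
    show "open (snd c ` (fst c \<inter> fst d))" using transition_domain_open ch by blast
    show "snd c p \<in> snd c ` (fst c \<inter> fst d)" using assms by auto
    show "(transition d e \<circ> transition c d) z = transition c e z"
      if "z \<in> snd c ` (fst c \<inter> fst d)" for z
      using that inj by (auto simp: transition_def)
  qed
  then show ?thesis by (metis comp_apply frechet_derivative_at)
qed

lemma tangent_of_in_tangent_space:
  assumes "smooth_manifold M A" "c \<in> A" "p \<in> fst c"
  shows "tangent_of A c p y \<in> tangent_space A p"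
  unfolding tangent_space_def
proof (intro CollectI conjI allI ballI impI)
  fix d e assume d: "d \<in> A" "p \<in> fst d" and e: "e \<in> A" "p \<in> fst e"
  show "tangent_of A c p y e =
      frechet_derivative (transition d e) (at (snd d p)) (tangent_of A c p y d)"
    unfolding tangent_of_def if_P[OF conjI[OF d]] if_P[OF conjI[OF e]]
    by (rule transition_cocycle[OF assms(1,2) d(1) e(1) assms(3) d(2) e(2)])
qed (auto simp: tangent_of_def)

lemma tangent_of_component:
  assumes "smooth_manifold M A" "c \<in> A" "p \<in> fst c"
  shows "tangent_of A c p y c = y"
proof -
  have ch: "is_chart M c" using assms by (auto simp: smooth_manifold_def)
  have "((\<lambda>z. z) has_derivative (\<lambda>z. z)) (at (snd c p))" by simp
  then have "(transition c c has_derivative (\<lambda>z. z)) (at (snd c p))"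
  proof (rule has_derivative_transform_within_open)
    show "open (chart_image c)" using ch by (simp add: is_chart_def)
  qed (use assms in \<open>auto simp: transition_def f_inv_into_f\<close>)
  then have "(\<lambda>z. z) = frechet_derivative (transition c c) (at (snd c p))"
    by (rule frechet_derivative_at)
  then show ?thesis using assms by (metis (no_types, lifting) tangent_of_def)
qed

lemma tangent_of_unique:
  assumes "v \<in> tangent_space A p" "c \<in> A" "p \<in> fst c"
  shows "tangent_of A c p (v c) = v"
proof
  fix d
  show "tangent_of A c p (v c) d = v d"
    using assms unfolding tangent_space_def tangent_of_def mem_Collect_eq by metis
qed

text \<open>The expression \<open>T(x,y)\<close> of a function \<open>T\<close> on the tangent bundle in the standard coordinates
  \<open>(x,y)\<close> induced by the chart \<open>c\<close>; it is meaningful for \<open>x \<in> chart_image c\<close>.\<close>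

definition in_chart :: "('a, 'n::finite) chart set \<Rightarrow> ('a, 'n) chart \<Rightarrow>
    ('a \<times> ('a, 'n) tvector \<Rightarrow> real) \<Rightarrow> real^'n \<Rightarrow> real^'n \<Rightarrow> real" where
  "in_chart A c T x y = T (chart_inv c x, tangent_of A c (chart_inv c x) y)"


section \<open>Finsler geometry in local coordinates\<close>

definition pdx :: "'n::finite \<Rightarrow> (real^'n \<Rightarrow> real^'n \<Rightarrow> real) \<Rightarrow> real^'n \<Rightarrow> real^'n \<Rightarrow> real" where
  "pdx i T x y = deriv (\<lambda>t. T (x + t *\<^sub>R axis i 1) y) 0"

definition pdy :: "'n::finite \<Rightarrow> (real^'n \<Rightarrow> real^'n \<Rightarrow> real) \<Rightarrow> real^'n \<Rightarrow> real^'n \<Rightarrow> real" where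
  "pdy i T x y = deriv (\<lambda>t. T x (y + t *\<^sub>R axis i 1)) 0"

definition fundamental_tensor ::
    "(real^'n::finite \<Rightarrow> real^'n \<Rightarrow> real) \<Rightarrow> real^'n \<Rightarrow> real^'n \<Rightarrow> real^'n^'n" where
  "fundamental_tensor F x y = (\<chi> i j. 1/2 * pdy j (pdy i (\<lambda>x y. (F x y)\<^sup>2)) x y)"

text \<open>The geodesic coefficients \<open>G\<^sup>i\<close>.\<close>

definition geodesic_coeff ::
    "(real^'n::finite \<Rightarrow> real^'n \<Rightarrow> real) \<Rightarrow> 'n \<Rightarrow> real^'n \<Rightarrow> real^'n \<Rightarrow> real" where
  "geodesic_coeff F i x y = 1/4 * (\<Sum>l\<in>UNIV. matrix_inv (fundamental_tensor F x y) $ i $ l *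
     ((\<Sum>m\<in>UNIV. pdy l (pdx m (\<lambda>x y. (F x y)\<^sup>2)) x y * y $ m) - pdx l (\<lambda>x y. (F x y)\<^sup>2) x y))"

text \<open>The components \<open>R\<^sup>i\<^sub>k\<close> of the Riemann curvature.\<close>

definition riemann_curvature ::
    "(real^'n::finite \<Rightarrow> real^'n \<Rightarrow> real) \<Rightarrow> 'n \<Rightarrow> 'n \<Rightarrow> real^'n \<Rightarrow> real^'n \<Rightarrow> real" where
  "riemann_curvature F i k x y = (let G = geodesic_coeff F in
     2 * pdx k (G i) x y
     - (\<Sum>l\<in>UNIV. pdy k (pdx l (G i)) x y * y $ l)
     + 2 * (\<Sum>l\<in>UNIV. G l x y * pdy k (pdy l (G i)) x y)
     - (\<Sum>l\<in>UNIV. pdy l (G i) x y * pdy k (G l) x y))"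

text \<open>The horizontal covariant derivatives \<open>T\<^bsub>|j\<^esub>\<close> of a function and \<open>T\<^bsub>i|j\<^esub>\<close> of a covector with
  respect to the Berwald connection of \<open>F\<close>.\<close>

definition hcov ::
    "(real^'n::finite \<Rightarrow> real^'n \<Rightarrow> real) \<Rightarrow> (real^'n \<Rightarrow> real^'n \<Rightarrow> real) \<Rightarrow>
     'n \<Rightarrow> real^'n \<Rightarrow> real^'n \<Rightarrow> real" where
  "hcov F T j x y = pdx j T x y - (\<Sum>m\<in>UNIV. pdy j (geodesic_coeff F m) x y * pdy m T x y)"

definition hcov_covector ::
    "(real^'n::finite \<Rightarrow> real^'n \<Rightarrow> real) \<Rightarrow> ('n \<Rightarrow> real^'n \<Rightarrow> real^'n \<Rightarrow> real) \<Rightarrow>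
     'n \<Rightarrow> 'n \<Rightarrow> real^'n \<Rightarrow> real^'n \<Rightarrow> real" where
  "hcov_covector F T i j x y = pdx j (T i) x y
     - (\<Sum>m\<in>UNIV. pdy j (geodesic_coeff F m) x y * pdy m (T i) x y)
     - (\<Sum>m\<in>UNIV. pdy j (pdy i (geodesic_coeff F m)) x y * T m x y)"


section \<open>Finsler metrics of scalar flag curvature\<close>

definition finsler_metric :: "'a topology \<Rightarrow> ('a, 'n::finite) chart set \<Rightarrow>
    ('a \<times> ('a, 'n) tvector \<Rightarrow> real) \<Rightarrow> bool" where
  "finsler_metric M A F \<longleftrightarrow>
     (\<forall>c\<in>A. smooth_on (\<lambda>(x, y). in_chart A c F x y) (chart_image c \<times> (UNIV - {0}))) \<and>
     (\<forall>(p, v)\<in>tangent_bundle M A. F (p, v) \<ge> 0 \<and> (F (p, v) = 0 \<longleftrightarrow> v = (\<lambda>_. 0))) \<and>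
     (\<forall>(p, v)\<in>tangent_bundle M A. \<forall>a\<ge>0. F (p, \<lambda>c. a *\<^sub>R v c) = a * F (p, v)) \<and>
     (\<forall>c\<in>A. \<forall>x\<in>chart_image c. \<forall>y. y \<noteq> 0 \<longrightarrow> (\<forall>w. w \<noteq> 0 \<longrightarrow>
        w \<bullet> (fundamental_tensor (in_chart A c F) x y *v w) > 0))"

text \<open>The flag curvature \<open>K\<close> is a function on the slit tangent bundle: only its values at nonzero
  tangent vectors are constrained.\<close>

definition scalar_flag_curvature :: "('a, 'n::finite) chart set \<Rightarrow>
    ('a \<times> ('a, 'n) tvector \<Rightarrow> real) \<Rightarrow> ('a \<times> ('a, 'n) tvector \<Rightarrow> real) \<Rightarrow> bool" where
  "scalar_flag_curvature A F K \<longleftrightarrow>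
     (\<forall>c\<in>A. \<forall>x\<in>chart_image c. \<forall>y. y \<noteq> 0 \<longrightarrow> (\<forall>i k.
        let F' = in_chart A c F; K' = in_chart A c K in
        riemann_curvature F' i k x y =
          K' x y * ((F' x y)\<^sup>2 * (if i = k then 1 else 0) - F' x y * pdy k F' x y * y $ i)))"

end

theory Submission
  imports Defs
begin

text \<open>Work in a chart. Let \<open>\<delta>\<^sub>k = \<partial>/\<partial>x\<^sup>k - N\<^sup>m\<^sub>k \<partial>/\<partial>y\<^sup>m\<close> with \<open>N\<^sup>i\<^sub>k = G\<^sup>i\<^sub>\<cdot>\<^sub>k\<close>, and let
  \<open>R\<^sup>i\<^sub>k\<^sub>l = \<delta>\<^sub>k N\<^sup>i\<^sub>l - \<delta>\<^sub>l N\<^sup>i\<^sub>k\<close> be the curvature of the horizontal distribution. Then \<open>R\<^sup>i\<^sub>k = R\<^sup>i\<^sub>k\<^sub>l y\<^sup>l\<close>, and the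
  vertical cyclic identity gives back \<open>3 R\<^sup>i\<^sub>k\<^sub>l = R\<^sup>i\<^sub>k\<^sub>\<cdot>\<^sub>l - R\<^sup>i\<^sub>l\<^sub>\<cdot>\<^sub>k\<close>. For scalar flag curvature this expresses
  \<open>R\<^sup>i\<^sub>k\<^sub>l\<close> through \<open>K\<close>, \<open>K\<^sub>\<cdot>\<^sub>k\<close>, \<open>\<theta>\<^sub>k = F F\<^sub>\<cdot>\<^sub>k\<close> and \<open>h\<^sup>i\<^sub>k = F\<^sup>2 \<delta>\<^sup>i\<^sub>k - \<theta>\<^sub>k y\<^sup>i\<close>. The horizontal Bianchi identity is the
  Jacobi identity for three of the fields \<open>\<delta>\<^sub>k\<close>; since \<open>F\<close> is annihilated by every \<open>\<delta>\<^sub>k\<close>, only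
  derivatives of \<open>K\<close> survive in it. Contracting it once with \<open>y\<close> and taking one trace leaves
  \<open>(n - 2) F\<close> times the claimed identity. The second form follows from \<open>(K\<^sub>|\<^sub>m)\<^sub>\<cdot>\<^sub>k = K\<^sub>\<cdot>\<^sub>k\<^sub>|\<^sub>m\<close>.\<close>

section \<open>Smooth functions on open sets\<close>

lemma Ck_on_cong:
  assumes "open S" "\<And>p. p \<in> S \<Longrightarrow> f p = g p" "Ck_on k f S"
  shows "Ck_on k g S"
  using assms(2,3)
proof (induction k arbitrary: f g)
  case 0
  then show ?case by (auto cong: continuous_on_cong)
next
  case (Suc k)
  have "g differentiable at p" if "p \<in> S" for p
  proof -
    from Suc.prems that obtain f' where "(f has_derivative f') (at p)"
      by (auto simp: differentiable_def)
    then have "(g has_derivative f') (at p)"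
      by (rule has_derivative_transform_within_open[OF _ assms(1) that]) (use Suc.prems in auto)
    then show ?thesis by (auto simp: differentiable_def)
  qed
  moreover have "Ck_on k (\<lambda>p. frechet_derivative g (at p) v) S" for v
  proof (rule Suc.IH)
    show "frechet_derivative f (at p) v = frechet_derivative g (at p) v" if "p \<in> S" for p
      using frechet_derivative_transform_within_open[of f p S g] Suc.prems that assms(1) by simp
  qed (use Suc.prems in auto)
  ultimately show ?case by simp
qed

text \<open>\<open>Ck_on\<close> speaks of the literal \<open>frechet_derivative\<close>; here an
  explicit formula \<open>D\<close>, valid on the open set \<open>S\<close>, may stand in for it.
  The closure rules for sums, products and inverses are inductions through this form.\<close>

lemma Ck_on_SucI:
  assumes D: "\<And>v. Ck_on k (D v) S"
    and S: "open S" and f: "\<And>p. p \<in> S \<Longrightarrow> f differentiable (at p)"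
    and eq: "\<And>p v. p \<in> S \<Longrightarrow> frechet_derivative f (at p) v = D v p"
  shows "Ck_on (Suc k) f S"
proof -
  have "Ck_on k (\<lambda>p. frechet_derivative f (at p) v) S" for v
    by (rule Ck_on_cong[OF S _ D[of v]]) (simp add: eq)
  then show ?thesis using f by simp
qed

text \<open>Differentiability gives continuity at the bottom level, and induction lifts this. The
  product and inverse rules need it because their derivatives still contain undifferentiated
  factors.\<close>

lemma Ck_on_SucD: "Ck_on (Suc k) f S \<Longrightarrow> Ck_on k f S"
proof (induction k arbitrary: f)
  case 0
  then show ?case
    by (auto intro!: continuous_at_imp_continuous_on differentiable_imp_continuous_within)
next
  case (Suc k)
  note f = Suc.prems[unfolded Ck_on.simps(2)[of "Suc k"]]
  have "Ck_on k (\<lambda>p. frechet_derivative f (at p) v) S" for v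
    by (rule Suc.IH[OF conjunct2[OF f, THEN spec]])
  then show ?case
    unfolding Ck_on.simps(2)[of k] using conjunct1[OF f] by simp
qed

lemma Ck_on_const: "Ck_on k (\<lambda>_. c) S"
proof (induction k arbitrary: c)
  case (Suc k)
  show ?case using Suc.IH[of 0] by simp
qed simp

lemma Ck_on_bounded_linear: "bounded_linear f \<Longrightarrow> Ck_on k f S"
proof (cases k)
  case (Suc j)
  assume f: "bounded_linear f"
  have "frechet_derivative f (at p) = f" for p
    by (rule frechet_derivative_at[OF bounded_linear_imp_has_derivative[OF f], symmetric])
  with Suc f show ?thesis by (simp add: Ck_on_const bounded_linear_imp_differentiable)
qed (simp add: linear_continuous_on)

lemma frechet_derivative_add:
  assumes "f differentiable at p" "g differentiable at p"
  shows "frechet_derivative (\<lambda>p. f p + g p) (at p) v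
     = frechet_derivative f (at p) v + frechet_derivative g (at p) v"
  by (rule frechet_derivative_at[OF has_derivative_add[OF assms[unfolded frechet_derivative_works]],
        symmetric, THEN fun_cong])

lemma Ck_on_add:
  assumes "open S" "Ck_on k f S" "Ck_on k g S"
  shows "Ck_on k (\<lambda>p. f p + g p) S"
  using assms(2,3)
proof (induction k arbitrary: f g)
  case (Suc k)
  have d: "f differentiable at p" "g differentiable at p" if "p \<in> S" for p
    using Suc.prems that by simp_all
  have "Ck_on k (\<lambda>p. frechet_derivative f (at p) v + frechet_derivative g (at p) v) S" for v
    using Suc.prems by (intro Suc.IH) auto
  then show ?case
    by (rule Ck_on_SucI[OF _ assms(1) differentiable_add[OF d] frechet_derivative_add[OF d]])
qed (simp add: continuous_on_add)

lemma frechet_derivative_mult: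
  fixes f g :: "'a::real_normed_vector \<Rightarrow> real"
  assumes "f differentiable at p" "g differentiable at p"
  shows "frechet_derivative (\<lambda>p. f p * g p) (at p) v
     = f p * frechet_derivative g (at p) v + frechet_derivative f (at p) v * g p"
  by (rule frechet_derivative_at[OF has_derivative_mult[OF assms[unfolded frechet_derivative_works]],
        symmetric, THEN fun_cong])

text \<open>The derivative is written purely as a product, so that \<open>Ck_on_mult\<close> applies
  to it in the induction for inverses.\<close>

lemma frechet_derivative_inverse:
  fixes f :: "'a::real_normed_vector \<Rightarrow> real"
  assumes "f differentiable at p" "f p \<noteq> 0"
  shows "frechet_derivative (\<lambda>p. inverse (f p)) (at p) v
     = (-1) * (frechet_derivative f (at p) v * (inverse (f p) * inverse (f p)))"
proof -
  from frechet_derivative_at[OF Deriv.has_derivative_inverse[OF assms(2) assms(1)[unfolded frechet_derivative_works]],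
      symmetric]
  show ?thesis by simp
qed

lemma Ck_on_mult:
  fixes f g :: "'a::real_normed_vector \<Rightarrow> real"
  assumes "open S" "Ck_on k f S" "Ck_on k g S"
  shows "Ck_on k (\<lambda>p. f p * g p) S"
  using assms(2,3)
proof (induction k arbitrary: f g)
  case (Suc k)
  have d: "f differentiable at p" "g differentiable at p" if "p \<in> S" for p
    using Suc.prems that by simp_all
  have D: "Ck_on k (\<lambda>p. frechet_derivative f (at p) v) S"
    "Ck_on k (\<lambda>p. frechet_derivative g (at p) v) S" for v
    using Suc.prems by simp_all
  have "Ck_on k (\<lambda>p. f p * frechet_derivative g (at p) v + frechet_derivative f (at p) v * g p) S" for v
    by (rule Ck_on_add[OF assms(1)]; rule Suc.IH; rule Ck_on_SucD[OF Suc.prems(1)]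
          Ck_on_SucD[OF Suc.prems(2)] D)
  then show ?case
    by (rule Ck_on_SucI[OF _ assms(1) differentiable_mult[OF d] frechet_derivative_mult[OF d]])
qed (simp add: continuous_on_mult)

lemma Ck_on_inverse:
  fixes f :: "'a::real_normed_vector \<Rightarrow> real"
  assumes "open S" "\<And>p. p \<in> S \<Longrightarrow> f p \<noteq> 0" "Ck_on k f S"
  shows "Ck_on k (\<lambda>p. inverse (f p)) S"
  using assms(3)
proof (induction k)
  case (Suc k)
  note IH = Suc.IH[OF Ck_on_SucD[OF Suc.prems]]
  have d: "f differentiable at p" if "p \<in> S" for p
    using Suc.prems that by simp
  have "Ck_on k (\<lambda>p. frechet_derivative f (at p) v) S" for v
    using Suc.prems by simp
  then have "Ck_on k (\<lambda>p. (-1) * (frechet_derivative f (at p) v * (inverse (f p) * inverse (f p)))) S"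
    for v by (intro Ck_on_mult assms(1) IH Ck_on_const)
  then show ?case
    by (rule Ck_on_SucI[OF _ assms(1) differentiable_inverse[OF d assms(2)]
        frechet_derivative_inverse[OF d assms(2)]])
qed (use assms(2) in \<open>simp add: continuous_on_inverse\<close>)

lemma smooth_on_cong:
  assumes "open S" "\<And>p. p \<in> S \<Longrightarrow> f p = g p" "smooth_on f S"
  shows "smooth_on g S"
  unfolding smooth_on_def
proof
  fix k
  have "Ck_on k f S" using assms(3) by (simp add: smooth_on_def)
  then show "Ck_on k g S" by (rule Ck_on_cong[OF assms(1), rotated]) (rule assms(2))
qed

lemma smooth_on_differentiable:
  assumes "smooth_on f S" "p \<in> S"
  shows "f differentiable at p"
proof -
  have "Ck_on (Suc 0) f S" using assms(1) unfolding smooth_on_def by (rule spec)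
  then show ?thesis using assms(2) by simp
qed

lemma smooth_on_frechet_derivative:
  "smooth_on f S \<Longrightarrow> smooth_on (\<lambda>p. frechet_derivative f (at p) v) S"
  unfolding smooth_on_def
proof
  fix k
  assume "\<forall>k. Ck_on k f S"
  then have "Ck_on (Suc k) f S" by (rule spec)
  then show "Ck_on k (\<lambda>p. frechet_derivative f (at p) v) S" by simp
qed

text \<open>The mean value theorem, applied once along \<open>v\<close> and once along
  \<open>w\<close>. The left side is symmetric in \<open>v\<close> and \<open>w\<close>, which is
  what will force mixed derivatives to agree.\<close>

lemma mvt_second_difference:
  fixes f :: "'a::real_normed_vector \<Rightarrow> real"
  assumes f: "Ck_on 2 f S" and h: "0 < h"
    and S: "\<And>s t. 0 \<le> s \<Longrightarrow> s \<le> h \<Longrightarrow> 0 \<le> t \<Longrightarrow> t \<le> h \<Longrightarrow> p + s *\<^sub>R v + t *\<^sub>R w \<in> S"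
  shows "\<exists>s t. 0 < s \<and> s < h \<and> 0 < t \<and> t < h \<and>
    f (p + h *\<^sub>R v + h *\<^sub>R w) - f (p + h *\<^sub>R v) - f (p + h *\<^sub>R w) + f p
      = h * h * frechet_derivative (\<lambda>q. frechet_derivative f (at q) v)
          (at (p + s *\<^sub>R v + t *\<^sub>R w)) w"
proof -
  let ?D = "\<lambda>q. frechet_derivative f (at q) v"
  have f1: "f differentiable at q" and f2: "?D differentiable at q" if "q \<in> S" for q
    using f that by (auto simp: numeral_2_eq_2)
  have d1: "((\<lambda>s. f (a + s *\<^sub>R v)) has_derivative
      (\<lambda>x. x * ?D (a + s *\<^sub>R v))) (at s within T)" if "a + s *\<^sub>R v \<in> S" for a s T
  proof -
    have "((\<lambda>s. f (a + s *\<^sub>R v)) has_derivative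
      (\<lambda>x. frechet_derivative f (at (a + s *\<^sub>R v)) (x *\<^sub>R v))) (at s within T)"
      by (rule has_derivative_compose[where g = f])
        (auto intro!: derivative_eq_intros simp: f1[OF that] frechet_derivative_works[symmetric])
    then show ?thesis
      using linear_frechet_derivative[OF f1[OF that]] by (simp add: linear_cmul)
  qed
  have d2: "((\<lambda>t. ?D (a + t *\<^sub>R w)) has_derivative
      (\<lambda>x. x * frechet_derivative ?D (at (a + t *\<^sub>R w)) w)) (at t within T)"
    if "a + t *\<^sub>R w \<in> S" for a t T
  proof -
    have "((\<lambda>t. ?D (a + t *\<^sub>R w)) has_derivative
      (\<lambda>x. frechet_derivative ?D (at (a + t *\<^sub>R w)) (x *\<^sub>R w))) (at t within T)"
      by (rule has_derivative_compose[where g = ?D])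
        (auto intro!: derivative_eq_intros simp: f2[OF that] frechet_derivative_works[symmetric])
    then show ?thesis
      using linear_frechet_derivative[OF f2[OF that]] by (simp add: linear_cmul)
  qed
  have S1: "p + h *\<^sub>R w + s *\<^sub>R v \<in> S" "p + s *\<^sub>R v \<in> S" if "0 \<le> s" "s \<le> h" for s
    using S[of s h] S[of s 0] that h by (simp_all add: add_ac)
  \<comment> \<open>The increment of \<open>f\<close> by \<open>h *\<^sub>R w\<close>, as a function
    of the position along \<open>v\<close>: its change over \<open>[0, h]\<close> is the second
    difference.\<close>
  have "\<exists>s\<in>{0<..<h}. (f (p + h *\<^sub>R w + h *\<^sub>R v) - f (p + h *\<^sub>R v))
      - (f (p + h *\<^sub>R w + 0 *\<^sub>R v) - f (p + 0 *\<^sub>R v))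
      = (h - 0) * ?D (p + h *\<^sub>R w + s *\<^sub>R v) - (h - 0) * ?D (p + s *\<^sub>R v)"
    by (rule mvt_simple[OF h, of "\<lambda>s. f (p + h *\<^sub>R w + s *\<^sub>R v) - f (p + s *\<^sub>R v)"
      "\<lambda>s x. x * ?D (p + h *\<^sub>R w + s *\<^sub>R v) - x * ?D (p + s *\<^sub>R v)"])
      (intro has_derivative_diff d1 S1)
  then obtain s where s: "0 < s" "s < h" and
    "(f (p + h *\<^sub>R w + h *\<^sub>R v) - f (p + h *\<^sub>R v))
      - (f (p + h *\<^sub>R w + 0 *\<^sub>R v) - f (p + 0 *\<^sub>R v))
      = (h - 0) * ?D (p + h *\<^sub>R w + s *\<^sub>R v) - (h - 0) * ?D (p + s *\<^sub>R v)"
    unfolding Bex_def greaterThanLessThan_iff by (elim exE conjE)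
  moreover have "p + h *\<^sub>R w + s *\<^sub>R v = p + s *\<^sub>R v + h *\<^sub>R w" for s
    by (simp add: add_ac)
  ultimately have
    e1: "f (p + h *\<^sub>R v + h *\<^sub>R w) - f (p + h *\<^sub>R v) - f (p + h *\<^sub>R w) + f p
      = h * (?D (p + s *\<^sub>R v + h *\<^sub>R w) - ?D (p + s *\<^sub>R v))"
    by (simp add: right_diff_distrib)
  have "\<exists>t\<in>{0<..<h}. ?D (p + s *\<^sub>R v + h *\<^sub>R w) - ?D (p + s *\<^sub>R v + 0 *\<^sub>R w)
      = (h - 0) * frechet_derivative ?D (at (p + s *\<^sub>R v + t *\<^sub>R w)) w"
    using mvt_simple[OF h, of "\<lambda>t. ?D (p + s *\<^sub>R v + t *\<^sub>R w)"
      "\<lambda>t x. x * frechet_derivative ?D (at (p + s *\<^sub>R v + t *\<^sub>R w)) w"]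
      d2 S[of s] s by auto
  then obtain t where "0 < t" "t < h" and
    "?D (p + s *\<^sub>R v + h *\<^sub>R w) - ?D (p + s *\<^sub>R v)
      = h * frechet_derivative ?D (at (p + s *\<^sub>R v + t *\<^sub>R w)) w"
    by auto
  with s e1 show ?thesis by (intro exI[of _ s] exI[of _ t]) simp
qed

text \<open>Schwarz's theorem. If the mixed derivatives differed at \<open>p\<close>, continuity
  would keep each within half the gap of its value at \<open>p\<close> on a small parallelogram,
  while the second difference makes them equal at two points of it.\<close>

lemma frechet_derivative_commute:
  fixes f :: "'a::real_normed_vector \<Rightarrow> real"
  assumes f: "Ck_on 2 f S" and "open S" "p \<in> S"
  shows "frechet_derivative (\<lambda>q. frechet_derivative f (at q) v) (at p) w
       = frechet_derivative (\<lambda>q. frechet_derivative f (at q) w) (at p) v"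
    (is "?A p = ?B p")
proof (rule ccontr)
  define \<epsilon> where "\<epsilon> = \<bar>?A p - ?B p\<bar> / 2"
  assume "?A p \<noteq> ?B p"
  then have "\<epsilon> > 0" by (simp add: \<epsilon>_def)
  have "continuous_on S ?A" "continuous_on S ?B"
    using f by (simp_all add: numeral_2_eq_2)
  then have "isCont ?A p" "isCont ?B p"
    using assms continuous_on_eq_continuous_at by blast+
  then obtain \<delta>1 \<delta>2 where \<delta>: "\<delta>1 > 0" "\<And>q. dist q p < \<delta>1 \<Longrightarrow> \<bar>?A q - ?A p\<bar> < \<epsilon>"
      "\<delta>2 > 0" "\<And>q. dist q p < \<delta>2 \<Longrightarrow> \<bar>?B q - ?B p\<bar> < \<epsilon>"
    using \<open>\<epsilon> > 0\<close> unfolding continuous_at_eps_delta dist_real_def by metis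
  obtain \<delta>3 where \<delta>3: "\<delta>3 > 0" "\<And>q. dist q p < \<delta>3 \<Longrightarrow> q \<in> S"
    using assms open_dist by metis
  define \<delta> where "\<delta> = Min {\<delta>1, \<delta>2, \<delta>3}"
  \<comment> \<open>\<open>N\<close> is positive even if both directions vanish, and every point of
    the parallelogram with sides \<open>h *\<^sub>R v\<close>, \<open>h *\<^sub>R w\<close> lies
    within \<open>h * N\<close>, half of \<open>\<delta>\<close>, of \<open>p\<close>.\<close>
  define N where "N = norm v + norm w + 1"
  define h where "h = \<delta> / N / 2"
  have pos: "N > 0" by (simp add: N_def add_nonneg_pos)
  have "\<delta> > 0" using \<delta> \<delta>3 by (simp add: \<delta>_def)
  then have "h > 0" using pos by (simp add: h_def)
  have small: "dist (p + s *\<^sub>R v + t *\<^sub>R w) p < \<delta>"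
    if "0 \<le> s" "s \<le> h" "0 \<le> t" "t \<le> h" for s t
  proof -
    have "dist (p + s *\<^sub>R v + t *\<^sub>R w) p \<le> norm (s *\<^sub>R v) + norm (t *\<^sub>R w)"
      by (metis add.assoc add_diff_cancel_left' dist_norm norm_triangle_ineq)
    also have "\<dots> \<le> h * norm v + h * norm w"
      using that by (auto intro!: add_mono mult_right_mono)
    also have "\<dots> < h * N"
      using \<open>h > 0\<close> by (simp add: algebra_simps N_def)
    also have "\<dots> = \<delta> / 2" using pos by (simp add: h_def)
    finally show ?thesis using \<open>\<delta> > 0\<close> by simp
  qed
  have S: "p + s *\<^sub>R v + t *\<^sub>R w \<in> S" if "0 \<le> s" "s \<le> h" "0 \<le> t" "t \<le> h" for s t
    using small[OF that] \<delta>3 by (simp add: \<delta>_def)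
  have S': "p + s *\<^sub>R w + t *\<^sub>R v \<in> S" if "0 \<le> s" "s \<le> h" "0 \<le> t" "t \<le> h" for s t
    using S[OF that(3,4,1,2)] by (simp add: add_ac)
  obtain s t where st: "0 < s" "s < h" "0 < t" "t < h"
    "f (p + h *\<^sub>R v + h *\<^sub>R w) - f (p + h *\<^sub>R v) - f (p + h *\<^sub>R w) + f p
      = h * h * ?A (p + s *\<^sub>R v + t *\<^sub>R w)"
    using mvt_second_difference[OF f \<open>h > 0\<close> S] by blast
  obtain s' t' where st': "0 < s'" "s' < h" "0 < t'" "t' < h"
    "f (p + h *\<^sub>R w + h *\<^sub>R v) - f (p + h *\<^sub>R w) - f (p + h *\<^sub>R v) + f p
      = h * h * ?B (p + s' *\<^sub>R w + t' *\<^sub>R v)"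
    using mvt_second_difference[OF f \<open>h > 0\<close> S'] by blast
  have e: "p + h *\<^sub>R w + h *\<^sub>R v = p + h *\<^sub>R v + h *\<^sub>R w"
    "p + s' *\<^sub>R w + t' *\<^sub>R v = p + t' *\<^sub>R v + s' *\<^sub>R w"
    by (simp_all add: add_ac)
  have "h * h * ?A (p + s *\<^sub>R v + t *\<^sub>R w) = h * h * ?B (p + t' *\<^sub>R v + s' *\<^sub>R w)"
    using st(5) st'(5)[unfolded e] by linarith
  then have "?A (p + s *\<^sub>R v + t *\<^sub>R w) = ?B (p + t' *\<^sub>R v + s' *\<^sub>R w)"
    using \<open>h > 0\<close> by simp
  moreover have "\<bar>?A (p + s *\<^sub>R v + t *\<^sub>R w) - ?A p\<bar> < \<epsilon>"
    using small[of s t] st \<delta> by (simp add: \<delta>_def)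
  moreover have "\<bar>?B (p + t' *\<^sub>R v + s' *\<^sub>R w) - ?B p\<bar> < \<epsilon>"
    using small[of t' s'] st' \<delta> by (simp add: \<delta>_def)
  moreover have "\<bar>?A p - ?B p\<bar> = 2 * \<epsilon>" by (simp add: \<epsilon>_def)
  ultimately show False by linarith
qed

section \<open>Calculus on the slit tangent bundle of a chart\<close>

text \<open>The bridge from the one-variable \<open>deriv\<close> in \<open>pdx\<close> and
  \<open>pdy\<close> to the Frechet derivative.\<close>

lemma deriv_along_line:
  fixes f :: "'a::real_normed_vector \<Rightarrow> real"
  assumes "f differentiable at p"
  shows "((\<lambda>t. f (p + t *\<^sub>R v)) has_field_derivative frechet_derivative f (at p) v) (at 0)"
proof -
  have f: "(f has_derivative frechet_derivative f (at p)) (at (p + 0 *\<^sub>R v))"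
    using assms by (simp add: frechet_derivative_works)
  have "((\<lambda>t. f (p + t *\<^sub>R v)) has_derivative (\<lambda>t. frechet_derivative f (at p) (t *\<^sub>R v))) (at 0)"
    by (rule has_derivative_compose[where g = f]) (use f in \<open>auto intro!: derivative_eq_intros\<close>)
  then show ?thesis
    using linear_frechet_derivative[OF assms]
    by (simp add: has_field_derivative_def linear_cmul mult.commute[of _ "frechet_derivative f (at p) v"])
qed

text \<open>The direction has a base and a fibre part, so \<open>pdx\<close>, \<open>pdy\<close> and
  the horizontal derivative are all instances; each rule of calculus is proved once here and
  inherited by them.\<close>

definition dirder :: "(real^'n::finite) \<times> (real^'n) \<Rightarrow> (real^'n \<Rightarrow> real^'n \<Rightarrow> real) \<Rightarrow>
    real^'n \<Rightarrow> real^'n \<Rightarrow> real" where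
  "dirder v T x y = frechet_derivative (case_prod T) (at (x, y)) v"

named_theorems smooth

locale slit_domain =
  fixes U :: "(real^'n::finite) set"
  assumes open_U: "open U"
begin

definition slit :: "((real^'n) \<times> (real^'n)) set" where
  "slit = U \<times> (UNIV - {0})"

abbreviation sm :: "(real^'n \<Rightarrow> real^'n \<Rightarrow> real) \<Rightarrow> bool" where
  "sm T \<equiv> smooth_on (case_prod T) slit"

lemma open_slit: "open slit"
  unfolding slit_def by (intro open_Times open_U) auto

text \<open>Most identities below hold only over \<open>U\<close> and off the zero section. That set
  is open, so they still transfer smoothness and, by \<open>dirder_cong\<close>,
  derivatives.\<close>

lemma sm_cong:
  assumes "\<And>x y. x \<in> U \<Longrightarrow> y \<noteq> 0 \<Longrightarrow> S x y = T x y" "sm S"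
  shows "sm T"
  by (rule smooth_on_cong[OF open_slit _ assms(2)]) (use assms(1) in \<open>auto simp: slit_def\<close>)

lemma sm_const [smooth]: "sm (\<lambda>x y. a)"
  by (simp add: smooth_on_def Ck_on_const case_prod_unfold)

lemma sm_component [smooth]: "sm (\<lambda>x y. y $ i)"
proof -
  have "bounded_linear (\<lambda>p :: (real^'n) \<times> (real^'n). snd p $ i)"
    by (rule bounded_linear_compose[OF bounded_linear_vec_nth bounded_linear_snd])
  then show ?thesis
    by (simp add: smooth_on_def Ck_on_bounded_linear case_prod_unfold)
qed

lemma sm_add [smooth]: "sm S \<Longrightarrow> sm T \<Longrightarrow> sm (\<lambda>x y. S x y + T x y)"
  by (simp add: smooth_on_def Ck_on_add case_prod_unfold open_slit)

lemma sm_mult [smooth]: "sm S \<Longrightarrow> sm T \<Longrightarrow> sm (\<lambda>x y. S x y * T x y)"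
  by (simp add: smooth_on_def Ck_on_mult case_prod_unfold open_slit)

lemma sm_minus [smooth]: "sm T \<Longrightarrow> sm (\<lambda>x y. - T x y)"
  using sm_mult[OF sm_const, of T "-1"] by simp

lemma sm_diff [smooth]: "sm S \<Longrightarrow> sm T \<Longrightarrow> sm (\<lambda>x y. S x y - T x y)"
  using sm_add[OF _ sm_minus, of S T] by simp

lemma sm_sum [smooth]: "(\<And>i. i \<in> I \<Longrightarrow> sm (T i)) \<Longrightarrow> sm (\<lambda>x y. \<Sum>i\<in>I. T i x y)"
  by (induction I rule: infinite_finite_induct) (auto intro: smooth)

lemma sm_prod [smooth]: "(\<And>i. i \<in> I \<Longrightarrow> sm (T i)) \<Longrightarrow> sm (\<lambda>x y. \<Prod>i\<in>I. T i x y)"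
  by (induction I rule: infinite_finite_induct) (auto intro: smooth)

lemma sm_power2 [smooth]: "sm T \<Longrightarrow> sm (\<lambda>x y. (T x y)\<^sup>2)"
  by (simp add: power2_eq_square smooth)

lemma sm_divide:
  assumes "sm S" "sm T" "\<And>x y. x \<in> U \<Longrightarrow> y \<noteq> 0 \<Longrightarrow> T x y \<noteq> 0"
  shows "sm (\<lambda>x y. S x y / T x y)"
proof -
  have "sm (\<lambda>x y. inverse (T x y))"
    using assms Ck_on_inverse[OF open_slit, of "case_prod T"]
    by (auto simp: smooth_on_def slit_def case_prod_unfold)
  from sm_mult[OF assms(1) this] show ?thesis by (simp add: divide_inverse)
qed

lemma sm_divide_const [smooth]: "sm T \<Longrightarrow> sm (\<lambda>x y. T x y / a)"
  using sm_mult[OF _ sm_const, of T "1 / a"] by simp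

lemma sm_det [smooth]:
  assumes "\<And>i j. sm (\<lambda>x y. B x y $ i $ j)"
  shows "sm (\<lambda>x y. det (B x y :: real^'n^'n))"
  unfolding det_def by (intro smooth assms)

context
  fixes x y :: "real^'n"
  assumes x: "x \<in> U" and y: "y \<noteq> 0"
begin

lemma sm_differentiable: "sm T \<Longrightarrow> case_prod T differentiable at (x, y)"
  by (rule smooth_on_differentiable) (use x y in \<open>auto simp: slit_def\<close>)

lemma dirder_cong:
  assumes "\<And>x y. x \<in> U \<Longrightarrow> y \<noteq> 0 \<Longrightarrow> S x y = T x y" "sm S"
  shows "dirder v S x y = dirder v T x y"
proof -
  have "frechet_derivative (case_prod S) (at (x, y)) = frechet_derivative (case_prod T) (at (x, y))"
    by (rule frechet_derivative_transform_within_open[OF sm_differentiable[OF assms(2)] open_slit])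
      (use x y assms(1) in \<open>auto simp: slit_def\<close>)
  then show ?thesis by (simp add: dirder_def)
qed

lemma dirder_const: "dirder v (\<lambda>x y. a) x y = 0"
  by (simp add: dirder_def case_prod_unfold)

lemma dirder_component: "dirder v (\<lambda>x y. y $ i) x y = snd v $ i"
proof -
  have "((\<lambda>p. snd p $ i) has_derivative (\<lambda>p. snd p $ i)) (at (x, y))"
    by (intro bounded_linear_imp_has_derivative bounded_linear_compose[OF bounded_linear_vec_nth]
        bounded_linear_snd)
  from frechet_derivative_at[OF this, symmetric] show ?thesis
    by (simp add: dirder_def case_prod_unfold)
qed

lemma dirder_add:
  assumes "sm S" "sm T"
  shows "dirder v (\<lambda>x y. S x y + T x y) x y = dirder v S x y + dirder v T x y"
proof -
  have "((\<lambda>p. case_prod S p + case_prod T p) has_derivative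
     (\<lambda>h. frechet_derivative (case_prod S) (at (x, y)) h + frechet_derivative (case_prod T) (at (x, y)) h))
     (at (x, y))"
    using assms[THEN sm_differentiable] by (intro has_derivative_add) (simp_all add: frechet_derivative_works)
  from frechet_derivative_at[OF this, symmetric] show ?thesis
    by (simp add: dirder_def case_prod_unfold)
qed

lemma dirder_mult:
  assumes "sm S" "sm T"
  shows "dirder v (\<lambda>x y. S x y * T x y) x y = S x y * dirder v T x y + dirder v S x y * T x y"
  using frechet_derivative_mult[OF assms[THEN sm_differentiable], of v]
  by (simp add: dirder_def case_prod_unfold)

lemma dirder_minus: "sm T \<Longrightarrow> dirder v (\<lambda>x y. - T x y) x y = - dirder v T x y"
  using dirder_mult[OF sm_const, of T v "-1"] by (simp add: dirder_const)

lemma dirder_diff: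
  "sm S \<Longrightarrow> sm T \<Longrightarrow> dirder v (\<lambda>x y. S x y - T x y) x y = dirder v S x y - dirder v T x y"
  using dirder_add[OF _ sm_minus, of S T v] by (simp add: dirder_minus)

lemma dirder_sum:
  "(\<And>i. i \<in> I \<Longrightarrow> sm (T i)) \<Longrightarrow>
    dirder v (\<lambda>x y. \<Sum>i\<in>I. T i x y) x y = (\<Sum>i\<in>I. dirder v (T i) x y)"
  by (induction I rule: infinite_finite_induct) (simp_all add: dirder_const dirder_add smooth)

lemma dirder_power2: "sm T \<Longrightarrow> dirder v (\<lambda>x y. (T x y)\<^sup>2) x y = 2 * T x y * dirder v T x y"
  by (simp add: power2_eq_square dirder_mult)

lemma pdx_eq_dirder: "sm T \<Longrightarrow> pdx i T x y = dirder (axis i 1, 0) T x y"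
  using DERIV_imp_deriv[OF deriv_along_line[OF sm_differentiable, of T "(axis i 1, 0)"]]
  by (simp add: pdx_def dirder_def)

lemma pdy_eq_dirder: "sm T \<Longrightarrow> pdy i T x y = dirder (0, axis i 1) T x y"
  using DERIV_imp_deriv[OF deriv_along_line[OF sm_differentiable, of T "(0, axis i 1)"]]
  by (simp add: pdy_def dirder_def)

lemma dirder_expand:
  assumes "sm T"
  shows "dirder (a, b) T x y = (\<Sum>i\<in>UNIV. a $ i * pdx i T x y) + (\<Sum>i\<in>UNIV. b $ i * pdy i T x y)"
proof -
  have lin: "linear (\<lambda>v. dirder v T x y)"
    unfolding dirder_def by (rule linear_frechet_derivative[OF sm_differentiable[OF assms]])
  have fst: "(a, 0) = (\<Sum>i\<in>UNIV. a $ i *\<^sub>R (axis i 1 :: real^'n, 0 :: real^'n))"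
    using basis_expansion[of a] by (simp add: prod_eq_iff fst_sum snd_sum scalar_mult_eq_scaleR)
  have snd: "(0, b) = (\<Sum>i\<in>UNIV. b $ i *\<^sub>R (0 :: real^'n, axis i 1 :: real^'n))"
    using basis_expansion[of b] by (simp add: prod_eq_iff fst_sum snd_sum scalar_mult_eq_scaleR)
  have "dirder (a, b) T x y = dirder ((a, 0) + (0, b)) T x y" by simp
  also have "\<dots> = dirder (a, 0) T x y + dirder (0, b) T x y"
    using lin by (rule linear_add)
  also have "dirder (a, 0) T x y = (\<Sum>i\<in>UNIV. a $ i * pdx i T x y)"
    unfolding fst using lin assms by (simp add: linear_sum[OF lin] linear_cmul[OF lin] pdx_eq_dirder
      del: scaleR_Pair)
  also have "dirder (0, b) T x y = (\<Sum>i\<in>UNIV. b $ i * pdy i T x y)"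
    unfolding snd using lin assms by (simp add: linear_sum[OF lin] linear_cmul[OF lin] pdy_eq_dirder
      del: scaleR_Pair)
  finally show ?thesis .
qed

end

lemma sm_dirder: "sm T \<Longrightarrow> sm (dirder v T)"
  using smooth_on_frechet_derivative[of "case_prod T" slit v]
  by (simp add: dirder_def case_prod_unfold)

lemma sm_pdx [smooth]: "sm T \<Longrightarrow> sm (pdx i T)"
  by (rule sm_cong[OF _ sm_dirder]) (auto simp: pdx_eq_dirder)

lemma sm_pdy [smooth]: "sm T \<Longrightarrow> sm (pdy i T)"
  by (rule sm_cong[OF _ sm_dirder]) (auto simp: pdy_eq_dirder)

lemma dirder_commute:
  assumes "x \<in> U" "y \<noteq> 0" "sm T"
  shows "dirder v (dirder w T) x y = dirder w (dirder v T) x y"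
proof -
  have "Ck_on 2 (case_prod T) slit" "(x, y) \<in> slit"
    using assms by (simp_all add: smooth_on_def slit_def)
  from frechet_derivative_commute[OF this(1) open_slit this(2)] show ?thesis
    by (simp add: dirder_def case_prod_beta')
qed

context
  fixes x y :: "real^'n"
  assumes x: "x \<in> U" and y: "y \<noteq> 0"
begin

lemma pd_commute:
  assumes "sm T"
  shows "pdx i (pdx j T) x y = pdx j (pdx i T) x y"
    and "pdy i (pdy j T) x y = pdy j (pdy i T) x y"
    and "pdx i (pdy j T) x y = pdy j (pdx i T) x y"
proof -
  note e = pdx_eq_dirder[OF x y] pdy_eq_dirder[OF x y]
  \<comment> \<open>\<open>pdx_eq_dirder\<close> and \<open>pdy_eq_dirder\<close> hold only on the
    slit domain, so an inner partial derivative has to be exchanged through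
    \<open>dirder_cong\<close>.\<close>
  have c: "dirder v (pdx i T) x y = dirder v (dirder (axis i 1, 0) T) x y"
    "dirder v (pdy i T) x y = dirder v (dirder (0, axis i 1) T) x y" for v i
    by (rule dirder_cong[OF x y]; simp add: assms pdx_eq_dirder pdy_eq_dirder smooth)+
  show "pdx i (pdx j T) x y = pdx j (pdx i T) x y"
    "pdy i (pdy j T) x y = pdy j (pdy i T) x y"
    "pdx i (pdy j T) x y = pdy j (pdx i T) x y"
    using assms by (simp_all add: e c smooth dirder_commute[OF x y assms, of "(axis i 1, 0)"]
       dirder_commute[OF x y assms, of "(0, axis i 1)"])
qed

lemma pdx_cong:
  assumes "\<And>x y. x \<in> U \<Longrightarrow> y \<noteq> 0 \<Longrightarrow> S x y = T x y" "sm S"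
  shows "pdx i S x y = pdx i T x y"
  using dirder_cong[OF x y assms] sm_cong[OF assms] assms(2) by (simp add: pdx_eq_dirder[OF x y])

lemma pdy_cong:
  assumes "\<And>x y. x \<in> U \<Longrightarrow> y \<noteq> 0 \<Longrightarrow> S x y = T x y" "sm S"
  shows "pdy i S x y = pdy i T x y"
  using dirder_cong[OF x y assms] sm_cong[OF assms] assms(2) by (simp add: pdy_eq_dirder[OF x y])

lemma pdx_const: "pdx i (\<lambda>x y. a) x y = 0"
  by (simp add: pdx_eq_dirder[OF x y] smooth dirder_const[OF x y])

lemma pdy_const: "pdy i (\<lambda>x y. a) x y = 0"
  by (simp add: pdy_eq_dirder[OF x y] smooth dirder_const[OF x y])

lemma pdx_component: "pdx i (\<lambda>x y. y $ j) x y = 0"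
  by (simp add: pdx_eq_dirder[OF x y] smooth dirder_component[OF x y])

lemma pdy_component: "pdy i (\<lambda>x y. y $ j) x y = (if i = j then 1 else 0)"
  by (simp add: pdy_eq_dirder[OF x y] smooth dirder_component[OF x y] axis_def)

lemma pdx_arith:
  "sm S \<Longrightarrow> sm T \<Longrightarrow> pdx i (\<lambda>x y. S x y + T x y) x y = pdx i S x y + pdx i T x y"
  "sm S \<Longrightarrow> sm T \<Longrightarrow> pdx i (\<lambda>x y. S x y - T x y) x y = pdx i S x y - pdx i T x y"
  "sm S \<Longrightarrow> sm T \<Longrightarrow> pdx i (\<lambda>x y. S x y * T x y) x y = S x y * pdx i T x y + pdx i S x y * T x y"
  "sm T \<Longrightarrow> pdx i (\<lambda>x y. - T x y) x y = - pdx i T x y"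
  "sm T \<Longrightarrow> pdx i (\<lambda>x y. (T x y)\<^sup>2) x y = 2 * T x y * pdx i T x y"
  by (simp_all add: pdx_eq_dirder[OF x y] smooth dirder_add[OF x y] dirder_diff[OF x y]
      dirder_mult[OF x y] dirder_minus[OF x y] dirder_power2[OF x y])

lemma pdy_arith:
  "sm S \<Longrightarrow> sm T \<Longrightarrow> pdy i (\<lambda>x y. S x y + T x y) x y = pdy i S x y + pdy i T x y"
  "sm S \<Longrightarrow> sm T \<Longrightarrow> pdy i (\<lambda>x y. S x y - T x y) x y = pdy i S x y - pdy i T x y"
  "sm S \<Longrightarrow> sm T \<Longrightarrow> pdy i (\<lambda>x y. S x y * T x y) x y = S x y * pdy i T x y + pdy i S x y * T x y"
  "sm T \<Longrightarrow> pdy i (\<lambda>x y. - T x y) x y = - pdy i T x y"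
  "sm T \<Longrightarrow> pdy i (\<lambda>x y. (T x y)\<^sup>2) x y = 2 * T x y * pdy i T x y"
  by (simp_all add: pdy_eq_dirder[OF x y] smooth dirder_add[OF x y] dirder_diff[OF x y]
      dirder_mult[OF x y] dirder_minus[OF x y] dirder_power2[OF x y])

lemma pd_sum:
  assumes "\<And>j. j \<in> J \<Longrightarrow> sm (T j)"
  shows "pdx i (\<lambda>x y. \<Sum>j\<in>J. T j x y) x y = (\<Sum>j\<in>J. pdx i (T j) x y)"
    and "pdy i (\<lambda>x y. \<Sum>j\<in>J. T j x y) x y = (\<Sum>j\<in>J. pdy i (T j) x y)"
  using assms by (simp_all add: pdx_eq_dirder[OF x y] pdy_eq_dirder[OF x y] smooth dirder_sum[OF x y])

lemmas pd_arith = pdx_const pdy_const pdx_component pdy_component pdx_arith pdy_arith pd_sum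

end

end

section \<open>Homogeneity and geodesic coefficients\<close>

context slit_domain
begin

text \<open>Homogeneity of degree \<open>r\<close> is taken in the form of Euler's relation, so that it can be
  differentiated.\<close>

definition homogeneous :: "real \<Rightarrow> (real^'n \<Rightarrow> real^'n \<Rightarrow> real) \<Rightarrow> bool" where
  "homogeneous r T \<longleftrightarrow> sm T \<and> (\<forall>x\<in>U. \<forall>y. y \<noteq> 0 \<longrightarrow> (\<Sum>i\<in>UNIV. y $ i * pdy i T x y) = r * T x y)"

lemma hom_smD: "homogeneous r T \<Longrightarrow> sm T"
  by (simp add: homogeneous_def)

lemma hom_eq: "homogeneous r T \<Longrightarrow> x \<in> U \<Longrightarrow> y \<noteq> 0 \<Longrightarrow> (\<Sum>i\<in>UNIV. y $ i * pdy i T x y) = r * T x y"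
  by (simp add: homogeneous_def)

lemma hom_eq': "homogeneous r T \<Longrightarrow> x \<in> U \<Longrightarrow> y \<noteq> 0 \<Longrightarrow> (\<Sum>i\<in>UNIV. pdy i T x y * y $ i) = r * T x y"
  using hom_eq by (simp add: mult.commute)

lemma hom_cong:
  assumes "\<And>x y. x \<in> U \<Longrightarrow> y \<noteq> 0 \<Longrightarrow> S x y = T x y" "homogeneous r S"
  shows "homogeneous r T"
  unfolding homogeneous_def
proof (intro conjI ballI allI impI)
  note S = hom_smD[OF assms(2)]
  show "sm T" by (rule sm_cong[OF assms(1) S])
  fix x y :: "real^'n" assume xy: "x \<in> U" "y \<noteq> 0"
  have "pdy i T x y = pdy i S x y" for i
    by (rule pdy_cong[OF xy assms(1) S, symmetric])
  then show "(\<Sum>i\<in>UNIV. y $ i * pdy i T x y) = r * T x y"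
    using hom_eq[OF assms(2) xy] assms(1)[OF xy] by simp
qed

lemma hom_pdx:
  assumes "homogeneous r T"
  shows "homogeneous r (pdx k T)"
  unfolding homogeneous_def
proof (intro conjI ballI allI impI)
  note T [smooth] = hom_smD[OF assms]
  show "sm (pdx k T)" by (intro smooth)
  fix x y :: "real^'n" assume xy: "x \<in> U" "y \<noteq> 0"
  note r = pd_arith[OF xy]
  have "pdx k (\<lambda>x y. \<Sum>i\<in>UNIV. y $ i * pdy i T x y) x y = pdx k (\<lambda>x y. r * T x y) x y"
    by (rule pdx_cong[OF xy]) (simp_all add: smooth hom_eq[OF assms])
  then show "(\<Sum>i\<in>UNIV. y $ i * pdy i (pdx k T) x y) = r * pdx k T x y"
    by (simp add: r smooth pd_commute(3)[OF xy T])
qed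

text \<open>Differentiating Euler's relation by \<open>y^k\<close> also hits the coefficient
  \<open>y^k\<close>; the extra term \<open>pdy k T\<close> lowers the degree by one. In
  \<open>hom_pdx\<close> there is no such term.\<close>

lemma hom_pdy:
  assumes "homogeneous r T"
  shows "homogeneous (r - 1) (pdy k T)"
  unfolding homogeneous_def
proof (intro conjI ballI allI impI)
  note T [smooth] = hom_smD[OF assms]
  show "sm (pdy k T)" by (intro smooth)
  fix x y :: "real^'n" assume xy: "x \<in> U" "y \<noteq> 0"
  note r = pd_arith[OF xy]
  have "pdy k (\<lambda>x y. \<Sum>i\<in>UNIV. y $ i * pdy i T x y) x y = pdy k (\<lambda>x y. r * T x y) x y"
    by (rule pdy_cong[OF xy]) (simp_all add: smooth hom_eq[OF assms])
  moreover have "pdy k (\<lambda>x y. \<Sum>i\<in>UNIV. y $ i * pdy i T x y) x y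
      = (\<Sum>i\<in>UNIV. y $ i * pdy i (pdy k T) x y) + pdy k T x y"
    by (simp add: r smooth pd_commute(2)[OF xy T, of k] sum.distrib mult_if_delta if_distrib[of "times a" for a] cong: if_cong)
  ultimately show "(\<Sum>i\<in>UNIV. y $ i * pdy i (pdy k T) x y) = (r - 1) * pdy k T x y"
    by (simp add: r smooth algebra_simps)
qed

lemma hom_mult:
  assumes "homogeneous r S" "homogeneous s T"
  shows "homogeneous (r + s) (\<lambda>x y. S x y * T x y)"
  unfolding homogeneous_def
proof (intro conjI ballI allI impI)
  note T [smooth] = assms[THEN hom_smD]
  show "sm (\<lambda>x y. S x y * T x y)" by (intro smooth)
  fix x y :: "real^'n" assume xy: "x \<in> U" "y \<noteq> 0"
  have "(\<Sum>i\<in>UNIV. y $ i * pdy i (\<lambda>x y. S x y * T x y) x y)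
    = S x y * (\<Sum>i\<in>UNIV. y $ i * pdy i T x y) + (\<Sum>i\<in>UNIV. y $ i * pdy i S x y) * T x y"
    by (simp add: pd_arith[OF xy] smooth sum.distrib sum_distrib_left sum_distrib_right algebra_simps)
  then show "(\<Sum>i\<in>UNIV. y $ i * pdy i (\<lambda>x y. S x y * T x y) x y) = (r + s) * (S x y * T x y)"
    by (simp add: hom_eq[OF assms(1) xy] hom_eq[OF assms(2) xy] algebra_simps)
qed

lemma hom_const: "homogeneous 0 (\<lambda>x y. a)"
  unfolding homogeneous_def by (auto simp: smooth pdy_const)

lemma hom_component: "homogeneous 1 (\<lambda>x y. y $ i)"
  unfolding homogeneous_def
  by (auto simp: smooth pdy_component if_distrib cong: if_cong)

lemma hom_diff:
  assumes "homogeneous r S" "homogeneous r T"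
  shows "homogeneous r (\<lambda>x y. S x y - T x y)"
  unfolding homogeneous_def
proof (intro conjI ballI allI impI)
  note T [smooth] = assms[THEN hom_smD]
  show "sm (\<lambda>x y. S x y - T x y)" by (intro smooth)
  fix x y :: "real^'n" assume xy: "x \<in> U" "y \<noteq> 0"
  have "(\<Sum>i\<in>UNIV. y $ i * pdy i (\<lambda>x y. S x y - T x y) x y)
    = (\<Sum>i\<in>UNIV. y $ i * pdy i S x y) - (\<Sum>i\<in>UNIV. y $ i * pdy i T x y)"
    by (simp add: pd_arith[OF xy] smooth sum_subtractf algebra_simps)
  then show "(\<Sum>i\<in>UNIV. y $ i * pdy i (\<lambda>x y. S x y - T x y) x y) = r * (S x y - T x y)"
    by (simp add: hom_eq[OF assms(1) xy] hom_eq[OF assms(2) xy] algebra_simps)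
qed

lemma hom_sum:
  assumes "\<And>j. j \<in> J \<Longrightarrow> homogeneous r (T j)"
  shows "homogeneous r (\<lambda>x y. \<Sum>j\<in>J. T j x y)"
  unfolding homogeneous_def
proof (intro conjI ballI allI impI)
  note T [smooth] = assms[THEN hom_smD]
  show "sm (\<lambda>x y. \<Sum>j\<in>J. T j x y)" by (intro smooth)
  fix x y :: "real^'n" assume xy: "x \<in> U" "y \<noteq> 0"
  have "(\<Sum>i\<in>UNIV. y $ i * pdy i (\<lambda>x y. \<Sum>j\<in>J. T j x y) x y)
    = (\<Sum>j\<in>J. \<Sum>i\<in>UNIV. y $ i * pdy i (T j) x y)"
    by (subst sum.swap) (simp add: pd_arith[OF xy] smooth sum_distrib_left)
  also have "\<dots> = (\<Sum>j\<in>J. r * T j x y)"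
    by (intro sum.cong refl hom_eq assms xy)
  finally show "(\<Sum>i\<in>UNIV. y $ i * pdy i (\<lambda>x y. \<Sum>j\<in>J. T j x y) x y) = r * (\<Sum>j\<in>J. T j x y)"
    by (simp add: sum_distrib_left)
qed

end

section \<open>Geodesic coefficients of a Finsler metric in one coordinate domain\<close>

locale finsler_domain = slit_domain U for U :: "(real^'n::finite) set" +
  fixes F :: "real^'n \<Rightarrow> real^'n \<Rightarrow> real"
  assumes sm_F [smooth]: "sm F"
    and F_pos: "x \<in> U \<Longrightarrow> y \<noteq> 0 \<Longrightarrow> F x y > 0"
    and F_scale: "x \<in> U \<Longrightarrow> y \<noteq> 0 \<Longrightarrow> a > 0 \<Longrightarrow> F x (a *\<^sub>R y) = a * F x y"
    and fundamental_tensor_pos: "x \<in> U \<Longrightarrow> y \<noteq> 0 \<Longrightarrow> w \<noteq> 0 \<Longrightarrow>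
      w \<bullet> (fundamental_tensor F x y *v w) > 0"
begin

text \<open>\<open>L\<close> lacks the factor one half, so its vertical Hessian is twice the
  fundamental tensor. \<open>N\<close> is the nonlinear connection whose horizontal fields are used
  throughout.\<close>

abbreviation L :: "real^'n \<Rightarrow> real^'n \<Rightarrow> real" where "L \<equiv> (\<lambda>x y. (F x y)\<^sup>2)"
abbreviation G :: "'n \<Rightarrow> real^'n \<Rightarrow> real^'n \<Rightarrow> real" where "G \<equiv> geodesic_coeff F"
abbreviation N :: "'n \<Rightarrow> 'n \<Rightarrow> real^'n \<Rightarrow> real^'n \<Rightarrow> real" where "N i k \<equiv> pdy k (G i)"

lemma sm_L [smooth]: "sm L"
  by (intro smooth)

text \<open>Along the ray through \<open>y\<close>, \<open>L\<close> is
  \<open>(1 + t)\<^sup>2 * L x y\<close>; Euler's relation is the derivative of this at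
  \<open>t = 0\<close>. The range \<open>t > -1\<close> keeps the scaling factor positive.\<close>

lemma hom_L: "homogeneous 2 L"
  unfolding homogeneous_def
proof (intro conjI ballI allI impI)
  fix x y :: "real^'n" assume xy: "x \<in> U" "y \<noteq> 0"
  have "((\<lambda>t. L x (y + t *\<^sub>R y)) has_field_derivative dirder (0, y) L x y) (at 0)"
    using deriv_along_line[OF sm_differentiable[OF xy sm_L], of "(0, y)"] by (simp add: dirder_def)
  moreover have "((\<lambda>t. L x (y + t *\<^sub>R y)) has_field_derivative 2 * L x y) (at 0)"
  proof (rule has_field_derivative_transform_within_open)
    show "((\<lambda>t. (1 + t)\<^sup>2 * L x y) has_field_derivative 2 * L x y) (at 0)"
      by (auto intro!: derivative_eq_intros)
    show "(1 + t)\<^sup>2 * L x y = L x (y + t *\<^sub>R y)" if "t \<in> {-1<..}" for t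
    proof -
      have "y + t *\<^sub>R y = (1 + t) *\<^sub>R y" by (simp add: algebra_simps)
      then show ?thesis using F_scale[OF xy, of "1 + t"] that by (simp add: power_mult_distrib)
    qed
  qed auto
  ultimately have "dirder (0, y) L x y = 2 * L x y" by (rule DERIV_unique)
  then show "(\<Sum>i\<in>UNIV. y $ i * pdy i L x y) = 2 * L x y"
    by (simp add: dirder_expand[OF xy sm_L])
qed (rule sm_L)

text \<open>Positive definiteness excludes a kernel. This is the device for cancelling the Hessian
  of \<open>L\<close> in \<open>hom_G\<close>.\<close>

lemma fundamental_tensor_kernel:
  assumes "x \<in> U" "y \<noteq> 0" "\<And>i. (\<Sum>j\<in>UNIV. pdy j (pdy i L) x y * w j) = 0"
  shows "w i = 0"
proof (rule ccontr)
  assume "w i \<noteq> 0"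
  then have "(\<chi> i. w i) \<noteq> 0" by (auto simp: vec_eq_iff)
  moreover have "fundamental_tensor F x y *v (\<chi> i. w i) = 0"
    using assms(3) unfolding fundamental_tensor_def matrix_vector_mult_def
    by (simp add: vec_eq_iff mult.assoc sum_distrib_left[symmetric] sum_divide_distrib[symmetric])
  ultimately show False using fundamental_tensor_pos[OF assms(1,2)] by fastforce
qed

text \<open>The Euler-Lagrange expression of \<open>L\<close> without its acceleration term, that
  is, the bracket of the geodesic coefficients before its index is raised.\<close>

definition spray_rhs :: "'n \<Rightarrow> real^'n \<Rightarrow> real^'n \<Rightarrow> real" where
  "spray_rhs i x y = (\<Sum>m\<in>UNIV. pdy i (pdx m L) x y * y $ m) - pdx i L x y"

lemma sm_spray_rhs [smooth]: "sm (spray_rhs i)"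
  unfolding spray_rhs_def by (intro smooth)

lemma det_fundamental_tensor:
  assumes "x \<in> U" "y \<noteq> 0"
  shows "det (fundamental_tensor F x y) \<noteq> 0"
proof -
  let ?g = "fundamental_tensor F x y"
  have "w = 0" if "?g *v w = 0" for w
    using fundamental_tensor_pos[OF assms, of w] that by force
  then have "\<exists>B. B ** ?g = mat 1" by (simp add: matrix_left_invertible_ker)
  then have "invertible ?g" by (simp add: invertible_left_inverse)
  then show ?thesis by (simp add: invertible_det_nz)
qed

lemma fundamental_tensor_geodesic_coeff:
  assumes "x \<in> U" "y \<noteq> 0"
  shows "fundamental_tensor F x y *v (\<chi> i. G i x y) = (\<chi> i. spray_rhs i x y / 4)"
proof -
  let ?g = "fundamental_tensor F x y"
  have "invertible ?g" using det_fundamental_tensor[OF assms] by (simp add: invertible_det_nz)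
  then have inv: "?g ** matrix_inv ?g = mat 1"
    unfolding invertible_def matrix_inv_def by (rule someI_ex[THEN conjunct1])
  have "(\<chi> i. G i x y) = matrix_inv ?g *v (\<chi> i. spray_rhs i x y / 4)"
    by (simp add: vec_eq_iff geodesic_coeff_def spray_rhs_def matrix_vector_mult_def sum_divide_distrib)
  then show ?thesis by (simp add: matrix_vector_mul_assoc inv)
qed

text \<open>The definition of \<open>G\<close> freed of the inverse matrix; in this form it can be
  differentiated.\<close>

lemma spray_eq:
  assumes "x \<in> U" "y \<noteq> 0"
  shows "(\<Sum>j\<in>UNIV. 2 * pdy j (pdy i L) x y * G j x y) = spray_rhs i x y"
proof -
  have "(\<Sum>j\<in>UNIV. 1/2 * pdy j (pdy i L) x y * G j x y) = spray_rhs i x y / 4"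
    using arg_cong[OF fundamental_tensor_geodesic_coeff[OF assms], of "\<lambda>v. v $ i"]
    by (simp add: fundamental_tensor_def matrix_vector_mult_def)
  then have "4 * (\<Sum>j\<in>UNIV. 1/2 * pdy j (pdy i L) x y * G j x y) = spray_rhs i x y" by simp
  then show ?thesis by (simp add: sum_distrib_left algebra_simps)
qed

text \<open>By Cramer's rule \<open>G k\<close> is a quotient of determinants with smooth entries,
  and the denominator does not vanish.\<close>

lemma sm_G [smooth]: "sm (G k)"
proof (rule sm_cong)
  let ?g = "\<lambda>x y. fundamental_tensor F x y"
  let ?b = "\<lambda>x y. (\<chi> i. spray_rhs i x y / 4) :: real^'n"
  let ?N = "\<lambda>x y. \<chi> i j. if j = k then ?b x y $ i else ?g x y $ i $ j"
  show "det (?N x y) / det (?g x y) = G k x y" if "x \<in> U" "y \<noteq> 0" for x y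
    using cramer[OF det_fundamental_tensor[OF that], of "\<chi> i. G i x y" "?b x y"]
      fundamental_tensor_geodesic_coeff[OF that] by (simp add: vec_eq_iff)
  have g: "sm (\<lambda>x y. ?g x y $ i $ j)" for i j
    unfolding fundamental_tensor_def by (simp add: smooth)
  have "sm (\<lambda>x y. 1/4 * spray_rhs i x y)" for i by (intro smooth)
  then have "sm (\<lambda>x y. ?N x y $ i $ j)" for i j
    using g by (cases "j = k") simp_all
  then show "sm (\<lambda>x y. det (?N x y) / det (?g x y))"
    by (intro sm_divide sm_det g det_fundamental_tensor)
qed

text \<open>Apply the Euler operator to \<open>spray_eq\<close>. The right side has degree 2 and the
  Hessian degree 0, so the Hessian annihilates the Euler operator of \<open>G\<close> minus
  \<open>2 * G\<close>, which must then vanish.\<close>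

lemma hom_G: "homogeneous 2 (G k)"
  unfolding homogeneous_def
proof (intro conjI ballI allI impI)
  fix x y :: "real^'n" assume xy: "x \<in> U" "y \<noteq> 0"
  have h0: "homogeneous 0 (pdy j (pdy i L))" for i j
    using hom_pdy[OF hom_pdy[OF hom_L]] by simp
  have "homogeneous 2 (spray_rhs i)" for i
  proof -
    have "homogeneous 2 (\<lambda>x y. \<Sum>m\<in>UNIV. pdy i (pdx m L) x y * y $ m)"
      using hom_mult[OF hom_pdy[OF hom_pdx[OF hom_L]] hom_component] by (intro hom_sum) simp
    then show ?thesis unfolding spray_rhs_def by (intro hom_diff hom_pdx[OF hom_L])
  qed
  then have h2: "homogeneous 2 (\<lambda>x y. \<Sum>j\<in>UNIV. 2 * pdy j (pdy i L) x y * G j x y)" for i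
    by (rule hom_cong[rotated]) (simp add: spray_eq)
  have "(\<Sum>j\<in>UNIV. pdy j (pdy i L) x y * ((\<Sum>m\<in>UNIV. y $ m * pdy m (G j) x y) - 2 * G j x y)) = 0" for i
  proof -
    have "(\<Sum>m\<in>UNIV. y $ m * pdy m (\<lambda>x y. \<Sum>j\<in>UNIV. 2 * pdy j (pdy i L) x y * G j x y) x y)
      = (\<Sum>m\<in>UNIV. \<Sum>j\<in>UNIV. 2 * pdy j (pdy i L) x y * (y $ m * pdy m (G j) x y)
          + 2 * (y $ m * pdy m (pdy j (pdy i L)) x y) * G j x y)"
      by (simp add: pd_arith[OF xy] smooth sum_distrib_left algebra_simps)
    also have "\<dots> = (\<Sum>j\<in>UNIV. 2 * pdy j (pdy i L) x y * (\<Sum>m\<in>UNIV. y $ m * pdy m (G j) x y)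
          + 2 * (\<Sum>m\<in>UNIV. y $ m * pdy m (pdy j (pdy i L)) x y) * G j x y)"
      by (subst sum.swap) (simp add: sum.distrib sum_distrib_left sum_distrib_right)
    also have "\<dots> = (\<Sum>j\<in>UNIV. 2 * pdy j (pdy i L) x y * (\<Sum>m\<in>UNIV. y $ m * pdy m (G j) x y))"
      by (simp add: hom_eq[OF h0 xy])
    finally have "(\<Sum>j\<in>UNIV. 2 * pdy j (pdy i L) x y * (\<Sum>m\<in>UNIV. y $ m * pdy m (G j) x y))
      = 2 * (\<Sum>j\<in>UNIV. 2 * pdy j (pdy i L) x y * G j x y)"
      using hom_eq[OF h2 xy, of i] by simp
    moreover have "2 * pdy j (pdy i L) x y * ((\<Sum>m\<in>UNIV. y $ m * pdy m (G j) x y) - 2 * G j x y)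
      = 2 * pdy j (pdy i L) x y * (\<Sum>m\<in>UNIV. y $ m * pdy m (G j) x y)
        - 2 * (2 * pdy j (pdy i L) x y * G j x y)" for j
      by (simp add: algebra_simps)
    ultimately have "(\<Sum>j\<in>UNIV. 2 * pdy j (pdy i L) x y * ((\<Sum>m\<in>UNIV. y $ m * pdy m (G j) x y)
      - 2 * G j x y)) = 0"
      by (simp add: sum_subtractf sum_distrib_left)
    then have "2 * (\<Sum>j\<in>UNIV. pdy j (pdy i L) x y * ((\<Sum>m\<in>UNIV. y $ m * pdy m (G j) x y)
      - 2 * G j x y)) = 0"
      by (simp only: sum_distrib_left mult.assoc)
    then show ?thesis by simp
  qed
  from fundamental_tensor_kernel[OF xy this] show "(\<Sum>i\<in>UNIV. y $ i * pdy i (G k) x y) = 2 * G k x y"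
    by simp
qed (intro smooth)

lemma hom_N: "homogeneous 1 (N i k)"
  using hom_pdy[OF hom_G] by simp

lemma sm_hcov [smooth]: "sm T \<Longrightarrow> sm (hcov F T k)"
  unfolding hcov_def by (intro smooth)

lemma hom_hcov: "homogeneous r T \<Longrightarrow> homogeneous r (hcov F T k)"
  using hom_mult[OF hom_N hom_pdy] unfolding hcov_def
  by (intro hom_diff hom_pdx hom_sum) simp_all

text \<open>Differentiate \<open>spray_eq\<close> by \<open>y\<^sup>k\<close> and contract with \<open>y\<close>.\<close>

lemma hcov_L:
  assumes xy: "x \<in> U" "y \<noteq> 0"
  shows "hcov F L k x y = 0"
proof -
  note r = pd_arith[OF xy]
  note c = pd_commute[OF xy]
  have a: "pdy k (\<lambda>x y. \<Sum>j\<in>UNIV. 2 * pdy j (pdy i L) x y * G j x y) x y = pdy k (spray_rhs i) x y" for i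
    by (rule pdy_cong[OF xy spray_eq]) (simp_all add: smooth)
  have b: "pdy k (\<lambda>x y. \<Sum>j\<in>UNIV. 2 * pdy j (pdy i L) x y * G j x y) x y
    = (\<Sum>j\<in>UNIV. 2 * pdy k (pdy j (pdy i L)) x y * G j x y + 2 * pdy j (pdy i L) x y * N j k x y)" for i
    by (simp add: r smooth algebra_simps)
  have d: "pdy k (spray_rhs i) x y = (\<Sum>m\<in>UNIV. pdy k (pdy i (pdx m L)) x y * y $ m)
      + pdy i (pdx k L) x y - pdy k (pdx i L) x y" for i
    unfolding spray_rhs_def
    by (simp add: r smooth sum.distrib mult_if_delta if_distrib[of "times a" for a] cong: if_cong)
  \<comment> \<open>The contractions with \<open>y^i\<close> are Euler relations: degree 0 for the
    Hessian of \<open>L\<close>, degree 1 for \<open>pdy j L\<close> and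
    \<open>pdy k (pdx m L)\<close>, degree 2 for \<open>pdx k L\<close>.\<close>
  have e1: "(\<Sum>i\<in>UNIV. y $ i * pdy k (pdy j (pdy i L)) x y) = 0" for j
  proof -
    have "pdy k (pdy j (pdy i L)) x y = pdy i (pdy k (pdy j L)) x y" for i
    proof -
      have "pdy k (pdy j (pdy i L)) x y = pdy k (pdy i (pdy j L)) x y"
        by (rule pdy_cong[OF xy]) (auto intro: smooth pd_commute)
      then show ?thesis by (simp add: c(2)[of "pdy j L"] smooth)
    qed
    then show ?thesis using hom_eq[OF hom_pdy[OF hom_pdy[OF hom_L]] xy, of k j] by simp
  qed
  have e2: "(\<Sum>i\<in>UNIV. y $ i * pdy j (pdy i L) x y) = pdy j L x y" for j
    using hom_eq[OF hom_pdy[OF hom_L] xy, of j] by (simp add: c(2)[of L j] smooth)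
  have e3: "(\<Sum>i\<in>UNIV. y $ i * pdy k (pdy i (pdx m L)) x y) = pdy k (pdx m L) x y" for m
    using hom_eq[OF hom_pdy[OF hom_pdx[OF hom_L]] xy, of k m] by (simp add: c(2)[of "pdx m L" k] smooth)
  have e4: "(\<Sum>i\<in>UNIV. y $ i * pdy i (pdx k L) x y) = 2 * pdx k L x y"
    by (rule hom_eq[OF hom_pdx[OF hom_L] xy])
  have "(\<Sum>i\<in>UNIV. y $ i * (\<Sum>j\<in>UNIV. 2 * pdy k (pdy j (pdy i L)) x y * G j x y
          + 2 * pdy j (pdy i L) x y * N j k x y))
    = (\<Sum>j\<in>UNIV. 2 * (\<Sum>i\<in>UNIV. y $ i * pdy k (pdy j (pdy i L)) x y) * G j x y
          + 2 * (\<Sum>i\<in>UNIV. y $ i * pdy j (pdy i L) x y) * N j k x y)"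
    by (simp only: sum_distrib_left sum_distrib_right, subst sum.swap)
       (simp add: sum.distrib[symmetric] algebra_simps)
  also have "\<dots> = 2 * (\<Sum>j\<in>UNIV. N j k x y * pdy j L x y)"
    unfolding e1 e2 by (simp add: sum_distrib_left algebra_simps)
  finally have lhs: "2 * (\<Sum>j\<in>UNIV. N j k x y * pdy j L x y)
    = (\<Sum>i\<in>UNIV. y $ i * ((\<Sum>m\<in>UNIV. pdy k (pdy i (pdx m L)) x y * y $ m)
      + pdy i (pdx k L) x y - pdy k (pdx i L) x y))"
    using a b d by simp
  have "(\<Sum>i\<in>UNIV. y $ i * (\<Sum>m\<in>UNIV. pdy k (pdy i (pdx m L)) x y * y $ m))
    = (\<Sum>m\<in>UNIV. (\<Sum>i\<in>UNIV. y $ i * pdy k (pdy i (pdx m L)) x y) * y $ m)"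
    by (simp only: sum_distrib_left sum_distrib_right, subst sum.swap) (simp add: algebra_simps)
  also have "\<dots> = (\<Sum>m\<in>UNIV. y $ m * pdy k (pdx m L) x y)"
    unfolding e3 by (simp add: mult.commute)
  \<comment> \<open>After contraction the first and third terms cancel, and the middle one gives
    \<open>2 * pdx k L x y\<close>.\<close>
  finally have "(\<Sum>i\<in>UNIV. y $ i * ((\<Sum>m\<in>UNIV. pdy k (pdy i (pdx m L)) x y * y $ m)
      + pdy i (pdx k L) x y - pdy k (pdx i L) x y)) = 2 * pdx k L x y"
    using e4 by (simp add: algebra_simps sum.distrib sum_subtractf)
  with lhs show ?thesis by (simp add: hcov_def)
qed

end

section \<open>Curvature and Bianchi identities\<close>

context finsler_domain
begin

text \<open>The direction is the field \<open>\<delta>\<^sub>k\<close> itself, so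
  \<open>hcov\<close> inherits linearity and the Leibniz rule from \<open>dirder\<close>.\<close>

lemma hcov_eq_dirder:
  assumes "x \<in> U" "y \<noteq> 0" "sm T"
  shows "hcov F T k x y = dirder (axis k 1, \<chi> m. - N m k x y) T x y"
  by (simp add: hcov_def dirder_expand[OF assms] sum_negf axis_def mult_if_delta)

text \<open>Here and below \<open>hcov F T k\<close> is the plain derivative of the component function \<open>T\<close> along
  \<open>\<delta>\<^sub>k\<close>, also when \<open>T\<close> carries indices.\<close>

definition curv :: "'n \<Rightarrow> 'n \<Rightarrow> 'n \<Rightarrow> real^'n \<Rightarrow> real^'n \<Rightarrow> real" where
  "curv i k l x y = hcov F (N i l) k x y - hcov F (N i k) l x y"

lemma sm_curv [smooth]: "sm (curv i k l)"
  unfolding curv_def by (intro smooth)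

lemma curv_swap: "curv i l k x y = - curv i k l x y"
  by (simp add: curv_def)

lemma hom_curv: "homogeneous 1 (curv i k l)"
  unfolding curv_def by (intro hom_diff hom_hcov hom_N)

lemma hcov_eq_fun: "hcov F T k = (\<lambda>x y. pdx k T x y - (\<Sum>p\<in>UNIV. N p k x y * pdy p T x y))"
  by (intro ext) (simp add: hcov_def)

context
  fixes x y :: "real^'n"
  assumes xy: "x \<in> U" "y \<noteq> 0"
begin

lemma hcov_cong:
  assumes "\<And>x y. x \<in> U \<Longrightarrow> y \<noteq> 0 \<Longrightarrow> S x y = T x y" "sm S"
  shows "hcov F S k x y = hcov F T k x y"
  using dirder_cong[OF xy assms] sm_cong[OF assms] assms(2) by (simp add: hcov_eq_dirder[OF xy])

lemma hcov_arith:
  "hcov F (\<lambda>x y. a) k x y = 0"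
  "hcov F (\<lambda>x y. y $ i) k x y = - N i k x y"
  "sm S \<Longrightarrow> sm T \<Longrightarrow> hcov F (\<lambda>x y. S x y + T x y) k x y = hcov F S k x y + hcov F T k x y"
  "sm S \<Longrightarrow> sm T \<Longrightarrow> hcov F (\<lambda>x y. S x y - T x y) k x y = hcov F S k x y - hcov F T k x y"
  "sm S \<Longrightarrow> sm T \<Longrightarrow>
    hcov F (\<lambda>x y. S x y * T x y) k x y = S x y * hcov F T k x y + hcov F S k x y * T x y"
  by (simp_all add: hcov_eq_dirder[OF xy] smooth dirder_add[OF xy] dirder_diff[OF xy]
      dirder_mult[OF xy] dirder_const[OF xy] dirder_component[OF xy])

lemma hcov_sum:
  assumes "\<And>j. j \<in> J \<Longrightarrow> sm (T j)"
  shows "hcov F (\<lambda>x y. \<Sum>j\<in>J. T j x y) k x y = (\<Sum>j\<in>J. hcov F (T j) k x y)"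
  using assms by (simp add: hcov_eq_dirder[OF xy] smooth dirder_sum[OF xy])

text \<open>The correction comes from the \<open>y\<close>-dependence of \<open>N\<close>; its
  coefficients \<open>pdy l (N p k)\<close> are those of the Berwald connection.\<close>

lemma pdy_hcov:
  assumes T [smooth]: "sm T"
  shows "pdy l (hcov F T k) x y = hcov F (pdy l T) k x y - (\<Sum>p\<in>UNIV. pdy l (N p k) x y * pdy p T x y)"
proof -
  have "pdy l (hcov F T k) x y = pdy l (\<lambda>x y. pdx k T x y - (\<Sum>p\<in>UNIV. N p k x y * pdy p T x y)) x y"
    by (simp only: hcov_eq_fun)
  also have "\<dots> = hcov F (pdy l T) k x y - (\<Sum>p\<in>UNIV. pdy l (N p k) x y * pdy p T x y)"
    by (simp add: pd_arith[OF xy] smooth hcov_def pd_commute(2)[OF xy T, of l]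
        pd_commute(3)[OF xy T] sum.distrib)
  finally show ?thesis .
qed

text \<open>The bracket of two horizontal fields is vertical, and \<open>curv\<close> gives its
  components.\<close>

lemma hcov_commutator:
  assumes T [smooth]: "sm T"
  shows "hcov F (hcov F T k) m x y - hcov F (hcov F T m) k x y
    = - (\<Sum>j\<in>UNIV. curv j m k x y * pdy j T x y)"
proof -
  \<comment> \<open>In this expansion everything except the last sum is symmetric under exchanging
    \<open>k\<close> and \<open>m\<close>, so only that sum survives the difference.\<close>
  have e: "hcov F (hcov F T k) m x y = pdx m (pdx k T) x y
      - (\<Sum>p\<in>UNIV. N p m x y * pdy p (pdx k T) x y) - (\<Sum>p\<in>UNIV. N p k x y * pdy p (pdx m T) x y)
      + (\<Sum>p\<in>UNIV. \<Sum>q\<in>UNIV. N p k x y * N q m x y * pdy q (pdy p T) x y)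
      - (\<Sum>p\<in>UNIV. hcov F (N p k) m x y * pdy p T x y)" for k m
  proof -
    have "hcov F (hcov F T k) m x y
      = hcov F (\<lambda>x y. pdx k T x y - (\<Sum>p\<in>UNIV. N p k x y * pdy p T x y)) m x y"
      by (simp only: hcov_eq_fun[of T])
    also have "\<dots> = hcov F (pdx k T) m x y - (\<Sum>p\<in>UNIV. N p k x y * hcov F (pdy p T) m x y)
        - (\<Sum>p\<in>UNIV. hcov F (N p k) m x y * pdy p T x y)"
      by (simp add: hcov_arith hcov_sum smooth sum.distrib)
    also have "hcov F (pdx k T) m x y = pdx m (pdx k T) x y
       - (\<Sum>p\<in>UNIV. N p m x y * pdy p (pdx k T) x y)"
      by (simp add: hcov_def)
    also have "(\<Sum>p\<in>UNIV. N p k x y * hcov F (pdy p T) m x y)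
      = (\<Sum>p\<in>UNIV. N p k x y * pdy p (pdx m T) x y)
       - (\<Sum>p\<in>UNIV. \<Sum>q\<in>UNIV. N p k x y * N q m x y * pdy q (pdy p T) x y)"
      by (simp add: hcov_def right_diff_distrib sum_subtractf sum_distrib_left mult.assoc
          pd_commute(3)[OF xy T])
    finally show ?thesis by simp
  qed
  have "(\<Sum>p\<in>UNIV. \<Sum>q\<in>UNIV. N p k x y * N q m x y * pdy q (pdy p T) x y)
    = (\<Sum>p\<in>UNIV. \<Sum>q\<in>UNIV. N p m x y * N q k x y * pdy q (pdy p T) x y)"
    by (subst sum.swap) (simp add: pd_commute(2)[OF xy T] mult.commute mult.left_commute)
  moreover have "pdx m (pdx k T) x y = pdx k (pdx m T) x y" by (rule pd_commute(1)[OF xy T])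
  moreover have "(\<Sum>j\<in>UNIV. curv j m k x y * pdy j T x y)
    = (\<Sum>p\<in>UNIV. hcov F (N p k) m x y * pdy p T x y) - (\<Sum>p\<in>UNIV. hcov F (N p m) k x y * pdy p T x y)"
    by (simp add: curv_def left_diff_distrib sum_subtractf)
  ultimately show ?thesis unfolding e[of k m] e[of m k] by linarith
qed

text \<open>The cyclic sum contains six iterated horizontal derivatives of entries of
  \<open>N\<close>. Grouped by the entry differentiated, they form three commutators.\<close>

lemma bianchi:
  "hcov F (curv i k l) m x y + hcov F (curv i l m) k x y + hcov F (curv i m k) l x y
    + (\<Sum>j\<in>UNIV. curv j k l x y * pdy j (N i m) x y) + (\<Sum>j\<in>UNIV. curv j l m x y * pdy j (N i k) x y)
    + (\<Sum>j\<in>UNIV. curv j m k x y * pdy j (N i l) x y) = 0"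
proof -
  have e: "hcov F (curv i k l) m x y = hcov F (hcov F (N i l) k) m x y - hcov F (hcov F (N i k) l) m x y"
    for k l m unfolding curv_def[abs_def] by (simp add: hcov_arith smooth)
  have c: "hcov F (hcov F (N i l) k) m x y - hcov F (hcov F (N i l) m) k x y
    = - (\<Sum>j\<in>UNIV. curv j m k x y * pdy j (N i l) x y)" for l m k
    by (rule hcov_commutator) (intro smooth)
  show ?thesis unfolding e using c[of l k m] c[of m l k] c[of k m l] by linarith
qed

lemma pdy_N_commute: "pdy m (N i l) x y = pdy l (N i m) x y"
  by (rule pd_commute(2)[OF xy sm_G])

end

text \<open>Closing and reopening the context of a fixed point makes \<open>pdy_N_commute\<close>
  available at every point, as \<open>hcov_cong\<close> requires. The later reopenings serve the
  same purpose.\<close>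

context
  fixes x y :: "real^'n"
  assumes xy: "x \<in> U" "y \<noteq> 0"
begin

lemma hcov_pdy_N_commute: "hcov F (pdy m (N i l)) k x y = hcov F (pdy l (N i m)) k x y"
  by (rule hcov_cong[OF xy pdy_N_commute]) (simp_all add: smooth)

text \<open>After \<open>pdy_hcov\<close> everything is expressed through
  \<open>pdy m (N i l)\<close>, which is symmetric in \<open>l\<close> and \<open>m\<close>, so the
  cyclic sum cancels in pairs.\<close>

lemma vertical_bianchi: "pdy m (curv i k l) x y + pdy k (curv i l m) x y + pdy l (curv i m k) x y = 0"
proof -
  have "pdy m (curv i k l) x y = hcov F (pdy m (N i l)) k x y - hcov F (pdy m (N i k)) l x y
      - (\<Sum>p\<in>UNIV. pdy m (N p k) x y * pdy p (N i l) x y)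
      + (\<Sum>p\<in>UNIV. pdy m (N p l) x y * pdy p (N i k) x y)" for k l m
    unfolding curv_def[abs_def] by (simp add: pd_arith[OF xy] pdy_hcov[OF xy] smooth)
  then show ?thesis
    by (simp add: pdy_N_commute[OF xy] hcov_pdy_N_commute)
qed

text \<open>Euler's relations for \<open>G\<close> (degree 2) and \<open>N\<close> (degree 1) turn
  the contraction of \<open>curv\<close> into the terms of the coordinate formula.\<close>

lemma riemann_eq_curv: "riemann_curvature F i k x y = (\<Sum>l\<in>UNIV. curv i k l x y * y $ l)"
proof -
  have s1: "(\<Sum>l\<in>UNIV. pdx k (N i l) x y * y $ l) = 2 * pdx k (G i) x y"
    using hom_eq'[OF hom_pdx[OF hom_G] xy, of k i] by (simp add: pd_commute(3)[OF xy sm_G])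
  have s2: "(\<Sum>l\<in>UNIV. pdy m (N i l) x y * y $ l) = N i m x y" for m
    using hom_eq'[OF hom_N xy, of m i] by (simp add: pdy_N_commute[OF xy, of m])
  have s3: "(\<Sum>l\<in>UNIV. N m l x y * y $ l) = 2 * G m x y" for m
    by (rule hom_eq'[OF hom_G xy])
  have "(\<Sum>l\<in>UNIV. hcov F (N i l) k x y * y $ l)
    = (\<Sum>l\<in>UNIV. pdx k (N i l) x y * y $ l) - (\<Sum>m\<in>UNIV. N m k x y * (\<Sum>l\<in>UNIV. pdy m (N i l) x y * y $ l))"
    unfolding sum_distrib_left by (subst sum.swap)
      (simp add: hcov_def left_diff_distrib sum_subtractf sum_distrib_right mult.assoc)
  moreover have "(\<Sum>l\<in>UNIV. hcov F (N i k) l x y * y $ l)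
    = (\<Sum>l\<in>UNIV. pdx l (N i k) x y * y $ l) - (\<Sum>m\<in>UNIV. (\<Sum>l\<in>UNIV. N m l x y * y $ l) * pdy m (N i k) x y)"
    unfolding sum_distrib_right by (subst sum.swap)
      (simp add: hcov_def left_diff_distrib right_diff_distrib sum_subtractf sum_distrib_left
        sum_distrib_right mult_ac)
  ultimately have "(\<Sum>l\<in>UNIV. curv i k l x y * y $ l)
    = 2 * pdx k (G i) x y - (\<Sum>m\<in>UNIV. N m k x y * N i m x y)
     - (\<Sum>l\<in>UNIV. pdx l (N i k) x y * y $ l) + (\<Sum>m\<in>UNIV. 2 * G m x y * pdy m (N i k) x y)"
    unfolding s1 s2 s3 by (simp add: curv_def left_diff_distrib sum_subtractf)
  moreover have "riemann_curvature F i k x y = 2 * pdx k (G i) x y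
     - (\<Sum>l\<in>UNIV. pdx l (N i k) x y * y $ l)
     + (\<Sum>m\<in>UNIV. 2 * G m x y * pdy m (N i k) x y) - (\<Sum>m\<in>UNIV. N m k x y * N i m x y)"
    by (simp add: riemann_curvature_def Let_def pd_commute(3)[OF xy sm_G] pdy_N_commute[OF xy, of k]
      sum_distrib_left mult_ac)
  ultimately show ?thesis by simp
qed

end

lemma sm_riemann [smooth]: "sm (riemann_curvature F i k)"
  by (rule sm_cong[of "\<lambda>x y. \<Sum>l\<in>UNIV. curv i k l x y * y $ l"]) (simp_all add: riemann_eq_curv smooth)

lemma hom_riemann: "homogeneous 2 (riemann_curvature F i k)"
proof (rule hom_cong[of "\<lambda>x y. \<Sum>l\<in>UNIV. curv i k l x y * y $ l"])
  show "homogeneous 2 (\<lambda>x y. \<Sum>l\<in>UNIV. curv i k l x y * y $ l)"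
    using hom_mult[OF hom_curv hom_component] by (intro hom_sum) simp
qed (simp add: riemann_eq_curv)

context
  fixes x y :: "real^'n"
  assumes xy: "x \<in> U" "y \<noteq> 0"
begin

text \<open>Differentiating \<open>riemann_eq_curv\<close> and antisymmetrizing yields two copies of
  \<open>curv\<close> directly. The third comes from the contracted terms, by the vertical Bianchi
  identity and homogeneity of degree 1.\<close>

lemma curv_eq_riemann:
  "3 * curv i k l x y = pdy l (riemann_curvature F i k) x y - pdy k (riemann_curvature F i l) x y"
proof -
  have e: "pdy l (riemann_curvature F i k) x y
      = curv i k l x y + (\<Sum>m\<in>UNIV. pdy l (curv i k m) x y * y $ m)" for k l
  proof -
    have "pdy l (riemann_curvature F i k) x y = pdy l (\<lambda>x y. \<Sum>m\<in>UNIV. curv i k m x y * y $ m) x y"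
      by (rule pdy_cong[OF xy riemann_eq_curv]) (simp_all add: smooth)
    then show ?thesis
      by (simp add: pd_arith[OF xy] smooth sum.distrib if_distrib[of "times a" for a] cong: if_cong)
  qed
  have sw: "pdy k (curv i m l) x y = - pdy k (curv i l m) x y" for k l m
  proof -
    have "pdy k (curv i m l) x y = pdy k (\<lambda>x y. - curv i l m x y) x y"
      by (rule pdy_cong[OF xy curv_swap]) (simp_all add: smooth)
    then show ?thesis by (simp add: pd_arith[OF xy] smooth)
  qed
  have "pdy l (curv i k m) x y - pdy k (curv i l m) x y = pdy m (curv i k l) x y" for m
    using vertical_bianchi[OF xy, of m i k l] sw[of l m k] by linarith
  then have "(\<Sum>m\<in>UNIV. pdy l (curv i k m) x y * y $ m) - (\<Sum>m\<in>UNIV. pdy k (curv i l m) x y * y $ m)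
    = (\<Sum>m\<in>UNIV. pdy m (curv i k l) x y * y $ m)"
    by (simp add: sum_subtractf[symmetric] left_diff_distrib[symmetric])
  also have "\<dots> = curv i k l x y" using hom_eq'[OF hom_curv xy] by simp
  finally show ?thesis
    unfolding e using curv_swap[of i l k] by simp
qed

end

text \<open>Half the vertical gradient of \<open>L\<close>, or \<open>y\<close> with its index
  lowered by the fundamental tensor.\<close>

definition theta :: "'n \<Rightarrow> real^'n \<Rightarrow> real^'n \<Rightarrow> real" where
  "theta k x y = F x y * pdy k F x y"

lemma sm_theta [smooth]: "sm (theta k)"
  unfolding theta_def by (intro smooth)

context
  fixes x y :: "real^'n"
  assumes xy: "x \<in> U" "y \<noteq> 0"
begin

lemma pdy_L: "pdy k L x y = 2 * theta k x y"
  by (simp add: pd_arith[OF xy] smooth theta_def)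

lemma sum_theta: "(\<Sum>k\<in>UNIV. theta k x y * y $ k) = L x y"
  using hom_eq'[OF hom_L xy] by (simp add: pdy_L sum_distrib_left[symmetric] mult.assoc)

end

context
  fixes x y :: "real^'n"
  assumes xy: "x \<in> U" "y \<noteq> 0"
begin

lemma pdy_theta_commute: "pdy l (theta k) x y = pdy k (theta l) x y"
proof -
  have "2 * pdy l (theta k) x y = pdy l (pdy k L) x y" for k l
  proof -
    have "pdy l (pdy k L) x y = pdy l (\<lambda>x y. 2 * theta k x y) x y"
      by (rule pdy_cong[OF xy pdy_L]) (simp_all add: smooth)
    then show ?thesis by (simp add: pd_arith[OF xy] smooth)
  qed
  from this[of l k] this[of k l] show ?thesis using pd_commute(2)[OF xy sm_L, of k l] by simp
qed

text \<open>The vertical derivative of \<open>hcov_L\<close> expresses the horizontal derivative of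
  \<open>theta\<close> through Berwald coefficients, which are symmetric in their lower
  indices.\<close>

lemma hcov_theta_commute: "hcov F (theta l) m x y = hcov F (theta m) l x y"
proof -
  have "pdy l (hcov F L m) x y = pdy l (\<lambda>x y. 0) x y" for l m
    by (rule pdy_cong[OF xy hcov_L]) (simp_all add: smooth)
  then have a: "hcov F (pdy l L) m x y = (\<Sum>p\<in>UNIV. pdy l (N p m) x y * pdy p L x y)" for l m
    using pdy_hcov[OF xy sm_L, of l m] by (simp add: pd_arith[OF xy])
  have b: "hcov F (pdy l L) m x y = hcov F (\<lambda>x y. 2 * theta l x y) m x y" for l m
    by (rule hcov_cong[OF xy pdy_L]) (simp_all add: smooth)
  have "2 * hcov F (theta l) m x y = (\<Sum>p\<in>UNIV. pdy l (N p m) x y * pdy p L x y)" for l m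
    using a[of l m] b[of l m] by (simp add: hcov_arith[OF xy] smooth)
  from this[of l m] this[of m l] show ?thesis by (simp add: pdy_N_commute[OF xy, of l])
qed

end

end

section \<open>Scalar flag curvature\<close>

locale scalar_curvature_domain = finsler_domain U F
  for U :: "(real^'n::finite) set" and F +
  fixes K :: "real^'n \<Rightarrow> real^'n \<Rightarrow> real"
  assumes dim: "CARD('n) \<ge> 3"
    and riemann_scalar: "x \<in> U \<Longrightarrow> y \<noteq> 0 \<Longrightarrow> riemann_curvature F i k x y =
      K x y * ((F x y)\<^sup>2 * (if i = k then 1 else 0) - F x y * pdy k F x y * y $ i)"
begin

abbreviation \<delta> :: "'n \<Rightarrow> 'n \<Rightarrow> real" where "\<delta> i k \<equiv> (if i = k then 1 else 0)"

text \<open>\<open>L\<close> times the projection along \<open>y\<close> onto the kernel of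
  \<open>theta\<close>.\<close>

definition angular :: "'n \<Rightarrow> 'n \<Rightarrow> real^'n \<Rightarrow> real^'n \<Rightarrow> real" where
  "angular i k x y = L x y * \<delta> i k - theta k x y * y $ i"

lemma sm_angular [smooth]: "sm (angular i k)"
  unfolding angular_def by (intro smooth)

lemma riemann_eq: "x \<in> U \<Longrightarrow> y \<noteq> 0 \<Longrightarrow> riemann_curvature F i k x y = K x y * angular i k x y"
  by (simp add: riemann_scalar angular_def theta_def)

lemma sum_angular:
  assumes "x \<in> U" "y \<noteq> 0"
  shows "(\<Sum>i\<in>UNIV. angular i i x y) = (real CARD('n) - 1) * L x y"
  using sum_theta[OF assms] by (simp add: angular_def sum_subtractf left_diff_distrib)

text \<open>Nothing is assumed about the regularity of \<open>K\<close>; it is a smooth function because it is a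
  multiple of the trace of the Riemann curvature.\<close>

lemma K_eq:
  assumes "x \<in> U" "y \<noteq> 0"
  shows "(\<Sum>i\<in>UNIV. riemann_curvature F i i x y) / ((real CARD('n) - 1) * L x y) = K x y"
proof -
  have "(\<Sum>i\<in>UNIV. riemann_curvature F i i x y) = K x y * ((real CARD('n) - 1) * L x y)"
    by (simp add: riemann_eq[OF assms] sum_distrib_left[symmetric] sum_angular[OF assms])
  moreover have "L x y \<noteq> 0" "real CARD('n) - 1 \<noteq> 0" using F_pos[OF assms] dim by auto
  ultimately show ?thesis by simp
qed

lemma sm_K [smooth]: "sm K"
proof (rule sm_cong[OF K_eq])
  have "(real CARD('n) - 1) * L x y \<noteq> 0" if "x \<in> U" "y \<noteq> 0" for x y
    using F_pos[OF that] dim by auto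
  then show "sm (\<lambda>x y. (\<Sum>i\<in>UNIV. riemann_curvature F i i x y) / ((real CARD('n) - 1) * L x y))"
    by (intro sm_divide smooth)
qed

text \<open>The trace of the Riemann curvature and \<open>L\<close> both have degree 2; Euler's
  relation for their link through \<open>K\<close> leaves degree 0.\<close>

lemma hom_K: "homogeneous 0 K"
  unfolding homogeneous_def
proof (intro conjI ballI allI impI)
  fix x y :: "real^'n" assume xy: "x \<in> U" "y \<noteq> 0"
  define c where "c = real CARD('n) - 1"
  have c: "c \<noteq> 0" "L x y \<noteq> 0" using dim F_pos[OF xy] by (auto simp: c_def)
  have e: "(\<Sum>i\<in>UNIV. riemann_curvature F i i x y) = K x y * (c * L x y)" if "x \<in> U" "y \<noteq> 0" for x y
    by (simp add: riemann_eq[OF that] sum_distrib_left[symmetric] sum_angular[OF that] c_def)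
  have "homogeneous 2 (\<lambda>x y. K x y * (c * L x y))"
    by (rule hom_cong[OF e hom_sum[OF hom_riemann]])
  from hom_eq[OF this xy]
  have "(\<Sum>i\<in>UNIV. y $ i * (K x y * (c * pdy i L x y) + pdy i K x y * (c * L x y)))
      = 2 * (K x y * (c * L x y))"
    by (simp add: pdy_arith[OF xy, of "K"] pdy_arith[OF xy, of "\<lambda>x y. c"] pdy_const[OF xy] smooth)
  also have "(\<Sum>i\<in>UNIV. y $ i * (K x y * (c * pdy i L x y) + pdy i K x y * (c * L x y)))
    = K x y * c * (\<Sum>i\<in>UNIV. y $ i * pdy i L x y) + (\<Sum>i\<in>UNIV. y $ i * pdy i K x y) * (c * L x y)"
    by (simp add: sum_distrib_left sum_distrib_right sum.distrib algebra_simps)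
  finally show "(\<Sum>i\<in>UNIV. y $ i * pdy i K x y) = 0 * K x y"
    using c by (simp add: hom_eq[OF hom_L xy] mult_ac)
qed (rule sm_K)

definition curv_scalar :: "'n \<Rightarrow> 'n \<Rightarrow> 'n \<Rightarrow> real^'n \<Rightarrow> real^'n \<Rightarrow> real" where
  "curv_scalar i k l x y = K x y * (theta l x y * \<delta> i k - theta k x y * \<delta> i l)
     + (1/3) * (pdy l K x y * angular i k x y - pdy k K x y * angular i l x y)"

context
  fixes x y :: "real^'n"
  assumes xy: "x \<in> U" "y \<noteq> 0"
begin

text \<open>In the antisymmetrization the vertical derivatives of \<open>theta\<close> cancel, and
  the \<open>\<delta>\<close> terms add up as 2 + 1; hence the factor 1/3 remains only at the
  gradient of \<open>K\<close>.\<close>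

lemma curv_eq_scalar: "curv i k l x y = curv_scalar i k l x y"
proof -
  have e: "pdy l (riemann_curvature F i k) x y = pdy l K x y * angular i k x y
     + K x y * (2 * theta l x y * \<delta> i k - pdy l (theta k) x y * y $ i - theta k x y * \<delta> i l)" for k l
  proof -
    have "pdy l (riemann_curvature F i k) x y = pdy l (\<lambda>x y. K x y * angular i k x y) x y"
      by (rule pdy_cong[OF xy riemann_eq]) (simp_all add: smooth)
    also have "\<dots> = pdy l K x y * angular i k x y
      + K x y * (2 * theta l x y * \<delta> i k - pdy l (theta k) x y * y $ i - theta k x y * \<delta> i l)"
      by (simp add: angular_def[abs_def] pd_arith(3-)[OF xy] pdy_const[OF xy] smooth theta_def[symmetric] mult.assoc)
    finally show ?thesis .
  qed
  have "3 * curv i k l x y = 3 * curv_scalar i k l x y"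
    using curv_eq_riemann[OF xy, of i k l]
    unfolding e pdy_theta_commute[OF xy, of l k] curv_scalar_def
    by (simp only: algebra_simps)
  then show ?thesis by simp
qed

end

context
  fixes x y :: "real^'n"
  assumes xy: "x \<in> U" "y \<noteq> 0"
begin

lemma hcov_angular: "hcov F (angular i k) m x y = theta k x y * N i m x y - hcov F (theta k) m x y * y $ i"
  unfolding angular_def[abs_def]
  by (simp add: hcov_arith[OF xy] hcov_L[OF xy] smooth)

text \<open>The quadratic terms of \<open>bianchi\<close>. The part of \<open>angular\<close> along
  \<open>y\<close> collapses because \<open>N\<close> has degree 1.\<close>

lemma sum_curv_scalar_berwald:
  "(\<Sum>j\<in>UNIV. curv_scalar j k l x y * pdy j (N i m) x y)
    = K x y * (theta l x y * pdy k (N i m) x y - theta k x y * pdy l (N i m) x y)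
     + (1/3) * (pdy l K x y * (L x y * pdy k (N i m) x y - theta k x y * N i m x y)
              - pdy k K x y * (L x y * pdy l (N i m) x y - theta l x y * N i m x y))"
proof -
  have d: "(\<Sum>j\<in>UNIV. \<delta> j k * pdy j (N i m) x y) = pdy k (N i m) x y" for k
    by (simp add: mult_if_delta)
  have a: "(\<Sum>j\<in>UNIV. angular j k x y * pdy j (N i m) x y) = L x y * pdy k (N i m) x y - theta k x y * N i m x y" for k
  proof -
    have "(\<Sum>j\<in>UNIV. angular j k x y * pdy j (N i m) x y) = L x y * (\<Sum>j\<in>UNIV. \<delta> j k * pdy j (N i m) x y)
      - theta k x y * (\<Sum>j\<in>UNIV. y $ j * pdy j (N i m) x y)"
      by (simp only: angular_def left_diff_distrib sum_subtractf sum_distrib_left mult.assoc)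
    then show ?thesis using d hom_eq[OF hom_N xy, of m i] by simp
  qed
  have "(\<Sum>j\<in>UNIV. curv_scalar j k l x y * pdy j (N i m) x y)
    = K x y * (theta l x y * (\<Sum>j\<in>UNIV. \<delta> j k * pdy j (N i m) x y) - theta k x y * (\<Sum>j\<in>UNIV. \<delta> j l * pdy j (N i m) x y))
     + (1/3) * (pdy l K x y * (\<Sum>j\<in>UNIV. angular j k x y * pdy j (N i m) x y)
              - pdy k K x y * (\<Sum>j\<in>UNIV. angular j l x y * pdy j (N i m) x y))"
    unfolding curv_scalar_def
    by (simp only: left_diff_distrib right_diff_distrib distrib_right distrib_left
        sum.distrib sum_subtractf sum_distrib_left mult.assoc)
  then show ?thesis by (simp only: d a)
qed

text \<open>This is \<open>K_{.l|m}\<close>, by \<open>hcov_covector_K\<close> below: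
  differentiating vertically last absorbs the connection term.\<close>

abbreviation dK :: "'n \<Rightarrow> 'n \<Rightarrow> real" where
  "dK l m \<equiv> pdy l (hcov F K m) x y"

lemma hcov_pdy_K: "hcov F (pdy l K) m x y = dK l m + (\<Sum>p\<in>UNIV. pdy l (N p m) x y * pdy p K x y)"
  by (simp add: pdy_hcov[OF xy sm_K])

lemma hcov_curv:
  "hcov F (curv i k l) m x y = hcov F K m x y * (theta l x y * \<delta> i k - theta k x y * \<delta> i l)
    + K x y * (hcov F (theta l) m x y * \<delta> i k - hcov F (theta k) m x y * \<delta> i l)
    + (1/3) * (hcov F (pdy l K) m x y * angular i k x y
        + pdy l K x y * (theta k x y * N i m x y - hcov F (theta k) m x y * y $ i)
        - hcov F (pdy k K) m x y * angular i l x y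
        - pdy k K x y * (theta l x y * N i m x y - hcov F (theta l) m x y * y $ i))"
proof -
  have "hcov F (curv i k l) m x y = hcov F (curv_scalar i k l) m x y"
    by (rule hcov_cong[OF xy curv_eq_scalar]) (simp_all add: smooth)
  also have "\<dots> = hcov F K m x y * (theta l x y * \<delta> i k - theta k x y * \<delta> i l)
    + K x y * (hcov F (theta l) m x y * \<delta> i k - hcov F (theta k) m x y * \<delta> i l)
    + (1/3) * (hcov F (pdy l K) m x y * angular i k x y + pdy l K x y * hcov F (angular i k) m x y
        - hcov F (pdy k K) m x y * angular i l x y - pdy k K x y * hcov F (angular i l) m x y)"
    unfolding curv_scalar_def[abs_def]
    by (simp only: hcov_arith[OF xy] smooth) (simp only: algebra_simps mult_zero_right mult_zero_left)
  finally show ?thesis by (simp only: hcov_angular)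
qed

text \<open>Inserted into \<open>bianchi\<close>, all terms with \<open>K\<close> itself or with its
  bare vertical derivatives cancel, by symmetry of the Berwald coefficients and of the horizontal
  derivative of \<open>theta\<close>.\<close>

lemma scalar_bianchi:
  "hcov F K m x y * (theta l x y * \<delta> i k - theta k x y * \<delta> i l)
   + hcov F K k x y * (theta m x y * \<delta> i l - theta l x y * \<delta> i m)
   + hcov F K l x y * (theta k x y * \<delta> i m - theta m x y * \<delta> i k)
   + (1/3) * ((dK l m - dK m l) * angular i k x y + (dK m k - dK k m) * angular i l x y
     + (dK k l - dK l k) * angular i m x y) = 0"
proof -
  define q where "q l m = (\<Sum>p\<in>UNIV. pdy l (N p m) x y * pdy p K x y)" for l m
  have q: "q l m = q m l" for l m
    unfolding q_def by (simp add: pdy_N_commute[OF xy, of l])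
  note t = hcov_theta_commute[OF xy]
  note n = pdy_N_commute[OF xy]
  have g: "(\<Sum>j\<in>UNIV. curv j k l x y * pdy j (N i m) x y) =
     (\<Sum>j\<in>UNIV. curv_scalar j k l x y * pdy j (N i m) x y)" for k l m
    by (simp only: curv_eq_scalar[OF xy])
  \<comment> \<open>Each symmetric quantity is brought to one order of its indices; afterwards
    collecting terms suffices.\<close>
  note sym = n[of l k i] n[of m k i] n[of m l i] t[of k l] t[of k m] t[of l m] q[of l k] q[of m k] q[of m l]
  show ?thesis
    using bianchi[OF xy, of i k l m]
    unfolding g sum_curv_scalar_berwald hcov_curv hcov_pdy_K q_def[symmetric] sym
    by (simp only: algebra_simps)
qed

lemma scalar_bianchi_trace:
  "(\<Sum>m\<in>UNIV. hcov F K m x y * y $ m) * theta k x y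
    = L x y * hcov F K k x y - 1/3 * L x y * (\<Sum>m\<in>UNIV. dK k m * y $ m)"
proof -
  define K0 where "K0 = (\<Sum>m\<in>UNIV. hcov F K m x y * y $ m)"
  define dK0 where "dK0 = (\<lambda>l. \<Sum>m\<in>UNIV. dK l m * y $ m)"
  \<comment> \<open>\<open>hcov F K l\<close> has degree 0, like \<open>K\<close>, so contracting
    its vertical derivative with \<open>y\<close> gives zero.\<close>
  have dK_y: "(\<Sum>m\<in>UNIV. dK m l * y $ m) = 0" for l
    using hom_eq'[OF hom_hcov[OF hom_K] xy, of l] by simp
  have \<delta>_y: "(\<Sum>m\<in>UNIV. \<delta> i m * y $ m) = y $ i" for i
    by (simp add: mult_if_delta)
  have \<delta>_sum: "(\<Sum>l\<in>UNIV. a l * \<delta> l k) = a k" for a :: "'n \<Rightarrow> real"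
    by (simp add: if_distrib[of "times a" for a] cong: if_cong)
  have ang_y: "(\<Sum>m\<in>UNIV. angular i m x y * y $ m) = 0" for i
  proof -
    have "(\<Sum>m\<in>UNIV. angular i m x y * y $ m)
      = L x y * (\<Sum>m\<in>UNIV. \<delta> i m * y $ m) - (\<Sum>m\<in>UNIV. theta m x y * y $ m) * y $ i"
      by (simp only: angular_def left_diff_distrib right_diff_distrib sum_subtractf sum_distrib_left
        sum_distrib_right mult_ac)
    then show ?thesis by (simp only: \<delta>_y sum_theta[OF xy])
  qed
  \<comment> \<open>\<open>scalar_bianchi\<close> contracted with \<open>y^m\<close>; the literal
    zeros stand for the contractions removed by \<open>dK_y\<close> and
    \<open>ang_y\<close>.\<close>
  have y_contr: "K0 * (theta l x y * \<delta> i k - theta k x y * \<delta> i l)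
    + hcov F K k x y * (L x y * \<delta> i l - theta l x y * y $ i)
    + hcov F K l x y * (theta k x y * y $ i - L x y * \<delta> i k)
    + (1/3) * ((dK0 l - 0) * angular i k x y + (0 - dK0 k) * angular i l x y
       + (dK k l - dK l k) * 0) = 0" (is "?lhs = 0") for i l
  proof -
    have "(\<Sum>m\<in>UNIV. (hcov F K m x y * y $ m) * (theta l x y * \<delta> i k - theta k x y * \<delta> i l)
     + hcov F K k x y * ((theta m x y * y $ m) * \<delta> i l - theta l x y * (\<delta> i m * y $ m))
     + hcov F K l x y * (theta k x y * (\<delta> i m * y $ m) - (theta m x y * y $ m) * \<delta> i k)
     + (1/3) * ((dK l m * y $ m - dK m l * y $ m) * angular i k x y
         + (dK m k * y $ m - dK k m * y $ m) * angular i l x y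
         + (dK k l - dK l k) * (angular i m x y * y $ m))) = 0"
    proof (intro sum.neutral ballI)
      fix m
      show "(hcov F K m x y * y $ m) * (theta l x y * \<delta> i k - theta k x y * \<delta> i l)
     + hcov F K k x y * ((theta m x y * y $ m) * \<delta> i l - theta l x y * (\<delta> i m * y $ m))
     + hcov F K l x y * (theta k x y * (\<delta> i m * y $ m) - (theta m x y * y $ m) * \<delta> i k)
     + (1/3) * ((dK l m * y $ m - dK m l * y $ m) * angular i k x y
         + (dK m k * y $ m - dK k m * y $ m) * angular i l x y
         + (dK k l - dK l k) * (angular i m x y * y $ m)) = 0"
        using arg_cong[OF scalar_bianchi[of m l i k], of "\<lambda>t. t * y $ m"]
        by (simp only: algebra_simps mult_zero_left)
    qed
    then show ?thesis
      by (simp only: sum.distrib sum_subtractf sum_distrib_left[symmetric] sum_distrib_right[symmetric]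
          K0_def[symmetric] dK0_def dK_y \<delta>_y ang_y sum_theta[OF xy])
  qed
  have dK0_y: "(\<Sum>l\<in>UNIV. dK0 l * y $ l) = 0"
  proof -
    have "(\<Sum>l\<in>UNIV. dK0 l * y $ l) = (\<Sum>m\<in>UNIV. (\<Sum>l\<in>UNIV. dK l m * y $ l) * y $ m)"
      unfolding dK0_def sum_distrib_right by (subst sum.swap) (simp only: mult_ac)
    then show ?thesis by (simp only: dK_y) simp
  qed
  \<comment> \<open>Since \<open>dK0\<close> annihilates \<open>y\<close>, \<open>angular\<close>
    acts on it as multiplication by \<open>L\<close>.\<close>
  have dK0_ang: "(\<Sum>l\<in>UNIV. dK0 l * angular l k x y) = L x y * dK0 k"
  proof -
    have "(\<Sum>l\<in>UNIV. dK0 l * angular l k x y)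
      = L x y * (\<Sum>l\<in>UNIV. dK0 l * \<delta> l k) - theta k x y * (\<Sum>l\<in>UNIV. dK0 l * y $ l)"
      by (simp only: angular_def left_diff_distrib right_diff_distrib sum_subtractf sum_distrib_left mult_ac)
    then show ?thesis by (simp only: \<delta>_sum dK0_y)
  qed
  define n where "n = real CARD('n)"
  \<comment> \<open>The trace: set \<open>i = l\<close> and sum, leaving \<open>k\<close>
    free.\<close>
  have "(\<Sum>l\<in>UNIV. K0 * (theta l x y * \<delta> l k - theta k x y)
    + hcov F K k x y * (L x y - theta l x y * y $ l)
    + (theta k x y * (hcov F K l x y * y $ l) - L x y * (hcov F K l x y * \<delta> l k))
    + (1/3) * (dK0 l * angular l k x y - dK0 k * angular l l x y)) = 0"
    using y_contr[of l l for l] by (intro sum.neutral ballI) (simp add: algebra_simps)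
  then have "K0 * ((\<Sum>l\<in>UNIV. theta l x y * \<delta> l k) - n * theta k x y)
    + hcov F K k x y * (n * L x y - (\<Sum>l\<in>UNIV. theta l x y * y $ l))
    + (theta k x y * (\<Sum>l\<in>UNIV. hcov F K l x y * y $ l) - L x y * (\<Sum>l\<in>UNIV. hcov F K l x y * \<delta> l k))
    + (1/3) * ((\<Sum>l\<in>UNIV. dK0 l * angular l k x y) - dK0 k * (\<Sum>l\<in>UNIV. angular l l x y)) = 0"
    by (simp only: sum.distrib sum_subtractf sum_distrib_left[symmetric] sum_constant n_def)
  then have "K0 * (theta k x y - n * theta k x y) + hcov F K k x y * (n * L x y - L x y)
    + (theta k x y * K0 - L x y * hcov F K k x y) + (1/3) * (L x y * dK0 k - dK0 k * ((n - 1) * L x y)) = 0"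
    unfolding \<delta>_sum sum_theta[OF xy] dK0_ang sum_angular[OF xy] K0_def[symmetric] n_def[symmetric] .
  \<comment> \<open>Each of the three kinds of terms occurs \<open>n - 1\<close> times with one sign
    and once with the other; dimension at least 3 allows cancelling the common factor.\<close>
  then have "(n - 2) * (K0 * theta k x y - (L x y * hcov F K k x y - 1/3 * L x y * dK0 k)) = 0"
    by algebra
  moreover have "n - 2 \<noteq> 0" using dim by (simp add: n_def)
  ultimately show ?thesis unfolding K0_def dK0_def by simp
qed

text \<open>The connection term in \<open>hcov_covector\<close> is exactly the correction in
  \<open>pdy_hcov\<close>.\<close>

lemma hcov_covector_K: "hcov_covector F (\<lambda>i. pdy i K) k m x y = dK k m"
  by (simp add: hcov_covector_def pdy_hcov[OF xy sm_K] hcov_def pdy_N_commute[OF xy, of k])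

text \<open>\<open>theta\<close> contains a factor \<open>F\<close> and \<open>L\<close> two, so
  \<open>scalar_bianchi_trace\<close> is \<open>F\<close> times this identity.\<close>

lemma scalar_curvature_identity:
  "F x y * hcov F K k x y - pdy k F x y * (\<Sum>m\<in>UNIV. hcov F K m x y * y $ m)
     - 1/3 * F x y * (\<Sum>m\<in>UNIV. hcov_covector F (\<lambda>i. pdy i K) k m x y * y $ m) = 0"
proof -
  have "F x y * (F x y * hcov F K k x y - pdy k F x y * (\<Sum>m\<in>UNIV. hcov F K m x y * y $ m)
     - 1/3 * F x y * (\<Sum>m\<in>UNIV. dK k m * y $ m)) = 0"
    using scalar_bianchi_trace[of k] by (simp add: theta_def power2_eq_square algebra_simps)
  then show ?thesis using F_pos[OF xy] by (simp add: hcov_covector_K)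
qed

lemma scalar_curvature_identity':
  "pdy k (\<lambda>x y. (\<Sum>m\<in>UNIV. hcov F K m x y * y $ m) / F x y) x y
     = 4/3 * ((\<Sum>m\<in>UNIV. hcov_covector F (\<lambda>i. pdy i K) k m x y * y $ m) / F x y)"
proof -
  let ?Q = "\<lambda>x y. \<Sum>m\<in>UNIV. hcov F K m x y * y $ m"
  let ?T = "\<lambda>x y. ?Q x y / F x y"
  have F0: "F x y \<noteq> 0" if "x \<in> U" "y \<noteq> 0" for x y using F_pos[OF that] by simp
  have Q: "sm ?Q" by (intro smooth)
  have T: "sm ?T" by (intro sm_divide Q sm_F F0)
  \<comment> \<open>The derivative of the quotient is obtained from the product rule for
    \<open>?T\<close> times \<open>F\<close>.\<close>
  have "pdy k ?Q x y = pdy k (\<lambda>x y. ?T x y * F x y) x y"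
    by (rule pdy_cong[OF xy]) (use F0 Q in simp_all)
  also have "\<dots> = ?T x y * pdy k F x y + pdy k ?T x y * F x y"
    by (rule pdy_arith(3)[OF xy T sm_F])
  finally have 1: "pdy k ?Q x y = ?T x y * pdy k F x y + pdy k ?T x y * F x y" .
  have 2: "pdy k ?Q x y = (\<Sum>m\<in>UNIV. dK k m * y $ m) + hcov F K k x y"
    by (simp add: pd_arith[OF xy] smooth sum.distrib if_distrib[of "times a" for a] cong: if_cong)
  have "F x y * F x y * pdy k ?T x y = F x y * (pdy k ?Q x y - ?T x y * pdy k F x y)"
    unfolding 1 by (simp add: algebra_simps)
  also have "\<dots> = F x y * (\<Sum>m\<in>UNIV. dK k m * y $ m) + F x y * hcov F K k x y - pdy k F x y * ?Q x y"
    unfolding 2 using F0[OF xy] by (simp add: algebra_simps)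
  \<comment> \<open>The first identity replaces the last two terms by one third of the first, whence
    4/3.\<close>
  also have "\<dots> = F x y * (4/3 * (\<Sum>m\<in>UNIV. dK k m * y $ m))"
    using scalar_curvature_identity[of k] unfolding hcov_covector_K by (simp add: algebra_simps)
  finally have "F x y * pdy k ?T x y = 4/3 * (\<Sum>m\<in>UNIV. dK k m * y $ m)"
    using F0[OF xy] by simp
  then show ?thesis using F0[OF xy] by (simp add: hcov_covector_K field_simps)
qed

end

end

section \<open>Passage from the manifold to a chart\<close>

lemma tangent_of_scaleR:
  assumes "smooth_manifold M A" "c \<in> A" "p \<in> fst c"
  shows "tangent_of A c p (a *\<^sub>R y) = (\<lambda>d. a *\<^sub>R tangent_of A c p y d)"
proof
  fix d
  show "tangent_of A c p (a *\<^sub>R y) d = a *\<^sub>R tangent_of A c p y d"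
  proof (cases "d \<in> A \<and> p \<in> fst d")
    case True
    then have "linear (frechet_derivative (transition c d) (at (snd c p)))"
      using assms by (intro linear_frechet_derivative transition_differentiable) auto
    then show ?thesis using True by (simp add: tangent_of_def linear_cmul)
  qed (auto simp: tangent_of_def)
qed

text \<open>\<open>tangent_of\<close> is linear in the components, and
  \<open>tangent_of_component\<close> recovers them. Thus nonzero components give a nonzero vector,
  and positivity and homogeneity descend from the tangent bundle.\<close>

lemma in_chart_finsler_domain:
  assumes M: "smooth_manifold M A" and F: "finsler_metric M A F" and c: "c \<in> A"
  shows "finsler_domain (chart_image c) (in_chart A c F)"
proof
  have "is_chart M c" using M c by (simp add: smooth_manifold_def)
  then show "open (chart_image c)" by (simp add: is_chart_def)
  fix x y :: "real^'b" and a :: real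
  assume x: "x \<in> chart_image c" and y: "y \<noteq> 0"
  define p where "p = chart_inv c x"
  have p: "p \<in> fst c" using x by (auto simp: p_def inv_into_into)
  then have pM: "p \<in> topspace M" using M c by (auto simp: smooth_manifold_def)
  have tb: "(p, tangent_of A c p y) \<in> tangent_bundle M A"
    using tangent_of_in_tangent_space[OF M c p] pM by (simp add: tangent_bundle_def)
  have "tangent_of A c p y \<noteq> (\<lambda>_. 0)"
    using tangent_of_component[OF M c p, of y] y by auto
  then show "in_chart A c F x y > 0"
    using F tb unfolding finsler_metric_def in_chart_def p_def[symmetric] by fastforce
  assume "a > 0"
  then show "in_chart A c F x (a *\<^sub>R y) = a * in_chart A c F x y"
    using F tb tangent_of_scaleR[OF M c p, of a y]
    unfolding finsler_metric_def in_chart_def p_def[symmetric] by fastforce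
next
  fix x y w :: "real^'b"
  assume "x \<in> chart_image c" "y \<noteq> 0" "w \<noteq> 0"
  then show "w \<bullet> (fundamental_tensor (in_chart A c F) x y *v w) > 0"
    using F c unfolding finsler_metric_def by blast
next
  interpret slit_domain "chart_image c"
    using M c by unfold_locales (simp add: smooth_manifold_def is_chart_def)
  show "smooth_on (case_prod (in_chart A c F)) (slit_domain.slit (chart_image c))"
    using F c unfolding finsler_metric_def slit_def by blast
qed

theorem lemma3p1:
  fixes M :: "'a topology" and A :: "('a, 'n::finite) chart set"
    and F K :: "'a \<times> ('a, 'n) tvector \<Rightarrow> real"
    and c :: "('a, 'n) chart" and F\<^sub>c K\<^sub>c :: "real^'n \<Rightarrow> real^'n \<Rightarrow> real"
    and x y :: "real^'n" and k :: 'n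
  assumes "CARD('n) \<ge> 3"
    and "smooth_manifold M A"
    and "finsler_metric M A F"
    and "scalar_flag_curvature A F K"
    and "c \<in> A" and "F\<^sub>c = in_chart A c F" and "K\<^sub>c = in_chart A c K"
    and "x \<in> chart_image c" and "y \<noteq> 0"
  shows "F\<^sub>c x y * hcov F\<^sub>c K\<^sub>c k x y
           - pdy k F\<^sub>c x y * (\<Sum>m\<in>UNIV. hcov F\<^sub>c K\<^sub>c m x y * y $ m)
           - 1/3 * F\<^sub>c x y * (\<Sum>m\<in>UNIV. hcov_covector F\<^sub>c (\<lambda>i. pdy i K\<^sub>c) k m x y * y $ m) = 0
       \<and> pdy k (\<lambda>x y. (\<Sum>m\<in>UNIV. hcov F\<^sub>c K\<^sub>c m x y * y $ m) / F\<^sub>c x y) x y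
           = 4/3 * ((\<Sum>m\<in>UNIV. hcov_covector F\<^sub>c (\<lambda>i. pdy i K\<^sub>c) k m x y * y $ m) / F\<^sub>c x y)"
proof -
  interpret finsler_domain "chart_image c" F\<^sub>c
    unfolding assms(6) by (rule in_chart_finsler_domain[OF assms(2,3,5)])
  interpret scalar_curvature_domain "chart_image c" F\<^sub>c K\<^sub>c
  proof
    show "riemann_curvature F\<^sub>c i k x y =
        K\<^sub>c x y * ((F\<^sub>c x y)\<^sup>2 * (if i = k then 1 else 0) - F\<^sub>c x y * pdy k F\<^sub>c x y * y $ i)"
      if "x \<in> chart_image c" "y \<noteq> 0" for x y i k
      using assms(4-7) that unfolding scalar_flag_curvature_def Let_def by blast
  qed (rule assms(1))
  show ?thesis
    using scalar_curvature_identity[OF assms(8,9)] scalar_curvature_identity'[OF assms(8,9)] by blast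
qed

end
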